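(* Let $M$ be Hrushovski's countable non-collapsed structure for a (not necessarily symmetric) ternary relation $R$ all of whose tuples consist of three distinct elements. Let $M_s$ be the $S$-structure (the $S$-reduct) obtained from Hrushovski's countable non-collapsed structure for a symmetric ternary relation. Then the pre-geometries $PG(M)$ and $PG(M_s)$ are isomorphic.
   Context: Hrushovski's construction. (Not necessarily symmetric case.) Structures are sets with a ternary relation $R$ holding only of triples of pairwise distinct elements; for finite $A$, $d_0(A)=|A|-|R_A|$ where $R_A\subseteq A^3$ is the set of ordered triples in the relation. (Symmetric case.) Structures are sets with a symmetric ternary relation $R$ holding only of triples of pairwise distinct elements; for finite $A$, $d_0(A)=|A|-r(A)$ where $r(A)$ is the number of three-element subsets $\{x,y,z\}\subseteq A$ with $R(x,y,z)$. In either case, for finite $A\subseteq N$, $A\leqslant N$ means $d_0(B)\ge d_0(A)$ for all finite $B$ with $A\subseteq B\subseteq N$; $\mathcal{C}$ is the class of finite structures $A$ with $\emptyset\leqslant A$; and the non-collapsed structure is the unique (up to isomorphism) countable structure all of whose finite substructures lie in $\mathcal{C}$ and such that whenever $A$ is a finite strong substructure of it and $A\leqslant B\in\mathcal{C}$, there is an embedding of $B$ into it over $A$ with strong image. Denote by $M$ the structure in the not necessarily symmetric case and by $M_{\mathrm{sym}}$ the one in the symmetric case. The structure $M_s$. It has the same universe as $M_{\mathrm{sym}}$. Its family of maximal cliques $C(M_s)$ consists of all sets of the form $\{c: R(c,x,y)\}$ with $x\ne y$ in $M_{\mathrm{sym}}$ that have at least $3$ elements, and the pre-multiplicity $\mathfrak{m}(C)$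 of $C\in C(M_s)$ is the number of unordered pairs $\{x,y\}$ with $C=\{c:R(c,x,y)\}$. (This is the reduct of $M_{\mathrm{sym}}$ to $S(x_1,x_2,x_3):=\exists x_4,x_5\bigwedge_{i}R(x_i,x_4,x_5)\wedge\bigwedge_{i\ne j}x_i\ne x_j$, together with multiplicities of cliques.) For a finite subset $A$ of $M_s$, the induced structure has $C(A)=\{C\cap A: C\in C(M_s),|C\cap A|\ge 3\}$ and $\mathfrak{m}_A(D)=\sum_{C\in C(M_s),\,C\cap A=D}\mathfrak{m}(C)$, and $$d_{0s}(A)=|A|-\sum_{D\in C(A)}\mathfrak{m}_A(D)\,(|D|-2).$$ Pre-geometries. For finite $A\subseteq M$ put $d(A)=\min\{d_0(B): A\subseteq B\subseteq M,\ B\text{ finite}\}$; for finite $A\subseteq M_s$ put $d_s(A)=\min\{d_{0s}(B):A\subseteq B\subseteq M_s,\ B\text{ finite}\}$. Each of these is the dimension function of a pre-geometry, denoted $PG(M)$ and $PG(M_s)$ respectively: a finite set $A$ is independent iff its dimension equals $|A|$, and $a$ is in the closure of a set $X$ iff there is a finite $X_0\subseteq X$ such that $X_0\cup\{a\}$ and $X_0$ have the same dimension. An isomorphism of pre-geometries is a bijection of the underlying sets that preserves independence of finite sets in both directions. *)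

theory Defs
  imports Main "HOL-Library.Countable_Set"
begin

type_synonym 'a rel3 = "('a \<times> 'a \<times> 'a) set"


section \<open>Ternary structures and their predimensions\<close>

definition ternary_structure :: "'a set \<Rightarrow> 'a rel3 \<Rightarrow> bool" where
  "ternary_structure N R \<longleftrightarrow>
     (\<forall>(x, y, z) \<in> R. x \<in> N \<and> y \<in> N \<and> z \<in> N \<and> x \<noteq> y \<and> x \<noteq> z \<and> y \<noteq> z)"

text \<open>The two transpositions below generate all permutations of the three coordinates.\<close>

definition sym_ternary_structure :: "'a set \<Rightarrow> 'a rel3 \<Rightarrow> bool" where
  "sym_ternary_structure N R \<longleftrightarrow>
     ternary_structure N R \<and> (\<forall>(x, y, z) \<in> R. (y, x, z) \<in> R \<and> (x, z, y) \<in> R)"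

text \<open>Substructures are induced, so the predimension of a finite set \<open>A\<close> is computed from the
  relation \<open>R\<close> of any ambient structure.\<close>

definition predim :: "'a rel3 \<Rightarrow> 'a set \<Rightarrow> int" where
  "predim R A = int (card A) - int (card (R \<inter> A \<times> A \<times> A))"

definition predim_sym :: "'a rel3 \<Rightarrow> 'a set \<Rightarrow> int" where
  "predim_sym R A = int (card A) -
     int (card {T. T \<subseteq> A \<and> card T = 3 \<and> (\<exists>x y z. T = {x, y, z} \<and> (x, y, z) \<in> R)})"


section \<open>Strong substructures and generic structures\<close>

text \<open>\<open>A \<le> N\<close> for a finite subset \<open>A\<close> of a possibly infinite \<open>N\<close>, relative to a predimension \<open>\<delta>\<close>.\<close>

definition strong :: "('a set \<Rightarrow> int) \<Rightarrow> 'a set \<Rightarrow> 'a set \<Rightarrow> bool" where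
  "strong \<delta> A N \<longleftrightarrow>
     finite A \<and> A \<subseteq> N \<and> (\<forall>B. finite B \<and> A \<subseteq> B \<and> B \<subseteq> N \<longrightarrow> \<delta> A \<le> \<delta> B)"

definition embedding :: "('a \<Rightarrow> 'b) \<Rightarrow> 'a set \<Rightarrow> 'a rel3 \<Rightarrow> 'b set \<Rightarrow> 'b rel3 \<Rightarrow> bool" where
  "embedding f A R B S \<longleftrightarrow> inj_on f A \<and> f ` A \<subseteq> B \<and>
     (\<forall>x\<in>A. \<forall>y\<in>A. \<forall>z\<in>A. (x, y, z) \<in> R \<longleftrightarrow> (f x, f y, f z) \<in> S)"

text \<open>The countable generic structure for the class of finite structures \<open>A\<close> with \<open>\<emptyset> \<le> A\<close>.  The
  parameters \<open>str\<close>, \<open>\<delta>\<close> say what a structure and its predimension are on the type of \<open>M\<close>, and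
  \<open>str'\<close>, \<open>\<delta>'\<close> are the same notions on \<^typ>\<open>nat\<close>: every finite structure has an isomorphic copy
  there.  Accordingly an extension \<open>A \<le> B\<close> is given by an embedding \<open>f\<close> of \<open>A\<close> onto a strong
  subset of \<open>B\<close>, and ``over \<open>A\<close>'' means \<open>g \<circ> f = id\<close> on \<open>A\<close>.\<close>

definition generic_structure ::
  "('a set \<Rightarrow> 'a rel3 \<Rightarrow> bool) \<Rightarrow> ('a rel3 \<Rightarrow> 'a set \<Rightarrow> int) \<Rightarrow>
   (nat set \<Rightarrow> nat rel3 \<Rightarrow> bool) \<Rightarrow> (nat rel3 \<Rightarrow> nat set \<Rightarrow> int) \<Rightarrow>
   'a set \<Rightarrow> 'a rel3 \<Rightarrow> bool" where
  "generic_structure str \<delta> str' \<delta>' M R \<longleftrightarrow>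
     countable M \<and> str M R \<and>
     (\<forall>A. finite A \<and> A \<subseteq> M \<longrightarrow> strong (\<delta> R) {} A) \<and>
     (\<forall>A B S f.
        strong (\<delta> R) A M \<and>
        finite B \<and> str' B S \<and> strong (\<delta>' S) {} B \<and>
        embedding f A R B S \<and> strong (\<delta>' S) (f ` A) B
        \<longrightarrow> (\<exists>g. embedding g B S M R \<and> (\<forall>a\<in>A. g (f a) = a) \<and> strong (\<delta> R) (g ` B) M))"

definition hrushovski_structure :: "'a set \<Rightarrow> 'a rel3 \<Rightarrow> bool" where
  "hrushovski_structure M R \<longleftrightarrow>
     generic_structure ternary_structure predim ternary_structure predim M R"

definition sym_hrushovski_structure :: "'a set \<Rightarrow> 'a rel3 \<Rightarrow> bool" where
  "sym_hrushovski_structure M R \<longleftrightarrow>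
     generic_structure sym_ternary_structure predim_sym sym_ternary_structure predim_sym M R"


section \<open>The reduct to cliques\<close>

definition clique_of :: "'a rel3 \<Rightarrow> 'a \<Rightarrow> 'a \<Rightarrow> 'a set" where
  "clique_of R x y = {c. (c, x, y) \<in> R}"

text \<open>A clique may be infinite, where \<^const>\<open>card\<close> is \<open>0\<close>.\<close>

definition cliques :: "'a set \<Rightarrow> 'a rel3 \<Rightarrow> 'a set set" where
  "cliques M R = {clique_of R x y | x y. x \<in> M \<and> y \<in> M \<and> x \<noteq> y \<and>
     (infinite (clique_of R x y) \<or> 3 \<le> card (clique_of R x y))}"

definition premult :: "'a set \<Rightarrow> 'a rel3 \<Rightarrow> 'a set \<Rightarrow> nat" where
  "premult M R C = card {{x, y} | x y. x \<in> M \<and> y \<in> M \<and> x \<noteq> y \<and> C = clique_of R x y}"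

text \<open>The structure induced on a finite set \<open>A\<close> by a family of cliques \<open>K\<close> with multiplicities \<open>m\<close>.
  In the symmetric generic structure, if \<open>k\<close> pairs are all related to the same three points, then
  \<open>0 \<le> (3 + 2 k) - 3 k\<close>, so \<open>k \<le> 3\<close>; hence the cardinality in \<^const>\<open>premult\<close> and the sums below
  range over finite sets.\<close>

definition induced_cliques :: "'a set set \<Rightarrow> 'a set \<Rightarrow> 'a set set" where
  "induced_cliques K A = {C \<inter> A | C. C \<in> K \<and> 3 \<le> card (C \<inter> A)}"

definition induced_mult :: "'a set set \<Rightarrow> ('a set \<Rightarrow> nat) \<Rightarrow> 'a set \<Rightarrow> 'a set \<Rightarrow> nat" where
  "induced_mult K m A D = (\<Sum>C \<in> {C \<in> K. C \<inter> A = D}. m C)"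

definition predim_cliques :: "'a set set \<Rightarrow> ('a set \<Rightarrow> nat) \<Rightarrow> 'a set \<Rightarrow> int" where
  "predim_cliques K m A = int (card A) -
     (\<Sum>D \<in> induced_cliques K A. int (induced_mult K m A D) * (int (card D) - 2))"

definition predim_s :: "'a set \<Rightarrow> 'a rel3 \<Rightarrow> 'a set \<Rightarrow> int" where
  "predim_s M R = predim_cliques (cliques M R) (premult M R)"


section \<open>Pregeometries\<close>

text \<open>The dimension function on finite subsets of \<open>N\<close> associated with a predimension \<open>\<delta>\<close>.\<close>

definition dimension :: "('a set \<Rightarrow> int) \<Rightarrow> 'a set \<Rightarrow> 'a set \<Rightarrow> int" where
  "dimension \<delta> N A = (LEAST n. \<exists>B. finite B \<and> A \<subseteq> B \<and> B \<subseteq> N \<and> n = \<delta> B)"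

text \<open>Pregeometries are given by their underlying sets and dimension functions on finite sets.\<close>

definition independent :: "('a set \<Rightarrow> int) \<Rightarrow> 'a set \<Rightarrow> bool" where
  "independent d A \<longleftrightarrow> d A = int (card A)"

definition pregeometry_isomorphic ::
  "'a set \<Rightarrow> ('a set \<Rightarrow> int) \<Rightarrow> 'b set \<Rightarrow> ('b set \<Rightarrow> int) \<Rightarrow> bool" where
  "pregeometry_isomorphic N d N' d' \<longleftrightarrow>
     (\<exists>h. bij_betw h N N' \<and>
       (\<forall>A. finite A \<and> A \<subseteq> N \<longrightarrow> (independent d A \<longleftrightarrow> independent d' (h ` A))))"

end

theory Submission
  imports Defs
begin

text \<open>
  Both pregeometries come from submodular predimensions, so the dimension of a subset of a finite
  strong set can be computed inside that strong set (\<open>dimension_strong\<close>).  The isomorphism is built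
  by back and forth along bijections between finite strong sets that preserve dimension.  What makes
  the extension step possible is that a structure may be exchanged for another one with the same
  pregeometry: let \<open>A\<close> be strong in \<open>B\<close>, and let the predimension of \<open>Y \<subseteq> B\<close> be that of
  \<open>Y \<inter> A\<close>, plus the number of points outside \<open>A\<close>, minus the total weight of the three-element
  subsets of \<open>Y\<close>, for some weighting of the triples not inside \<open>A\<close>.  Then the dimension function
  of \<open>B\<close> depends on \<open>A\<close> only through the dimension function of \<open>A\<close>
  (\<open>dimension_ext_predim_cong\<close>).

  Hence it is enough to know two things about each side.  First, every finite strong extension
  \<open>A \<subseteq> B\<close> has the dimension function of such an extension by weighted triples
  (\<open>triple_resolvable\<close>).  Second, every extension by weighted triples in which \<open>A\<close> is strong is
  realised by a strong set over \<open>A\<close> (\<open>triple_rich\<close>).  Two countable structures with both properties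
  have isomorphic pregeometries (\<open>pregeometry_isomorphic_triple_geometries\<close>).

  For an arbitrary ternary relation the weight of a triple is the number of its orderings that lie in
  the relation.  Strongness of \<open>A\<close> bounds the weight of a triple by \<open>3\<close>, and a triple has six
  orderings, so any prescribed weight can be installed and genericity applies.

  For the reduct, the predimension of \<open>Y\<close> is \<open>|Y|\<close> minus the sum of \<open>max 0 (|C\<^sub>p \<inter> Y| - 2)\<close> over all
  pairs \<open>p\<close>, where \<open>C\<^sub>p\<close> is the set of points related to \<open>p\<close> (\<open>predim_s_eq\<close>).  A clique \<open>D\<close> has the
  same pregeometry as the triples \<open>{e\<^sub>1, e\<^sub>2, d}\<close> through two fixed points of \<open>D\<close>, because both make
  every point of \<open>D\<close> depend on any two others; this gives the first property.  Conversely, a triple of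
  weight \<open>k\<close> becomes a clique of multiplicity \<open>k\<close> once \<open>k\<close> new pairs of points are attached to it, and
  attaching such a pair costs \<open>2 - 3 = -1\<close>, exactly as much as one unit of weight; this gives the
  second property.

  The delicate point is that a set which is strong for the symmetric relation is also strong for the
  reduct (\<open>strong_predim_s\<close>), although a relation \<open>{x, y, z}\<close> is counted for the pair \<open>{x, y}\<close> as
  well as for \<open>{x, z}\<close> and \<open>{y, z}\<close>.  Strongness is a Hall condition: the relations outside a strong
  set \<open>F\<close> can be assigned distinct points, each relation one of its own points outside \<open>F\<close>.  For a
  pair \<open>p\<close>, at most two relations through \<open>p\<close> are assigned a point of \<open>p\<close>; these are the two which the
  definition of the clique predimension gives away, and every other one pays with its own third point.
\<close>

section \<open>Predimensions and their dimension functions\<close>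

definition submodular :: "'a set \<Rightarrow> ('a set \<Rightarrow> int) \<Rightarrow> bool" where
  "submodular N \<delta> \<longleftrightarrow> (\<forall>X Y. finite X \<and> finite Y \<and> X \<subseteq> N \<and> Y \<subseteq> N \<longrightarrow>
     \<delta> (X \<union> Y) + \<delta> (X \<inter> Y) \<le> \<delta> X + \<delta> Y)"

lemma submodularD:
  "submodular N \<delta> \<Longrightarrow> finite X \<Longrightarrow> finite Y \<Longrightarrow> X \<subseteq> N \<Longrightarrow> Y \<subseteq> N \<Longrightarrow>
     \<delta> (X \<union> Y) + \<delta> (X \<inter> Y) \<le> \<delta> X + \<delta> Y"
  unfolding submodular_def by blast

lemma strongD:
  assumes "strong \<delta> A N"
  shows "finite A" "A \<subseteq> N" "\<And>B. finite B \<Longrightarrow> A \<subseteq> B \<Longrightarrow> B \<subseteq> N \<Longrightarrow> \<delta> A \<le> \<delta> B"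
  using assms unfolding strong_def by auto

lemma strong_subset: "strong \<delta> A N \<Longrightarrow> A \<subseteq> B \<Longrightarrow> B \<subseteq> N \<Longrightarrow> strong \<delta> A B"
  unfolding strong_def by auto

lemma strong_cong:
  assumes "\<And>Y. Y \<subseteq> B \<Longrightarrow> \<delta> Y = \<epsilon> Y"
  shows "strong \<delta> A B \<longleftrightarrow> strong \<epsilon> A B"
  using assms unfolding strong_def by metis

lemma submodular_Int_strong:
  assumes "submodular N \<delta>" "strong \<delta> B N" "finite X" "X \<subseteq> N"
  shows "\<delta> (X \<inter> B) \<le> \<delta> X"
proof -
  have "\<delta> (X \<union> B) + \<delta> (X \<inter> B) \<le> \<delta> X + \<delta> B"
    using assms strongD[OF assms(2)] by (intro submodularD) auto
  moreover have "\<delta> B \<le> \<delta> (X \<union> B)"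
    using assms strongD[OF assms(2)] by auto
  ultimately show ?thesis by linarith
qed

lemma submodular_cong:
  assumes "submodular N \<epsilon>" and eq: "\<And>Y. finite Y \<Longrightarrow> Y \<subseteq> N \<Longrightarrow> \<delta> Y = \<epsilon> Y"
  shows "submodular N \<delta>"
  unfolding submodular_def
proof (intro allI impI, elim conjE)
  fix X Y assume XY: "finite X" "finite Y" "X \<subseteq> N" "Y \<subseteq> N"
  then show "\<delta> (X \<union> Y) + \<delta> (X \<inter> Y) \<le> \<delta> X + \<delta> Y"
    using submodularD[OF assms(1) XY] by (simp add: eq le_infI1)
qed

lemma strong_trans:
  assumes "submodular N \<delta>" "strong \<delta> A B" "strong \<delta> B N"
  shows "strong \<delta> A N"
proof -
  have "\<delta> A \<le> \<delta> X" if "finite X" "A \<subseteq> X" "X \<subseteq> N" for X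
  proof -
    have "\<delta> A \<le> \<delta> (X \<inter> B)"
      using that strongD[OF assms(2)] by auto
    also have "\<dots> \<le> \<delta> X"
      using submodular_Int_strong assms that by blast
    finally show ?thesis .
  qed
  then show ?thesis
    using strongD[OF assms(2)] strongD[OF assms(3)] unfolding strong_def by auto
qed

lemma minimal_superset:
  assumes "strong \<delta> {} N" "finite A" "A \<subseteq> N"
  shows "\<exists>B. finite B \<and> A \<subseteq> B \<and> B \<subseteq> N \<and>
    (\<forall>X. finite X \<and> A \<subseteq> X \<and> X \<subseteq> N \<longrightarrow> \<delta> B \<le> \<delta> X)"
proof -
  let ?P = "\<lambda>B. finite B \<and> A \<subseteq> B \<and> B \<subseteq> N"
  have "\<exists>B. ?P B \<and> (\<forall>X. ?P X \<longrightarrow> nat (\<delta> B - \<delta> {}) \<le> nat (\<delta> X - \<delta> {}))"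
    by (rule ex_has_least_nat[of ?P A]) (use assms in auto)
  then obtain B where B: "?P B" "\<forall>X. ?P X \<longrightarrow> nat (\<delta> B - \<delta> {}) \<le> nat (\<delta> X - \<delta> {})"
    by blast
  have "\<delta> B \<le> \<delta> X" if X: "?P X" for X
  proof -
    have "\<delta> {} \<le> \<delta> X" using strongD(3)[OF assms(1)] X by auto
    moreover have "nat (\<delta> B - \<delta> {}) \<le> nat (\<delta> X - \<delta> {})" using B(2) X by blast
    ultimately show ?thesis by linarith
  qed
  with B(1) show ?thesis by blast
qed

lemma strong_superset:
  assumes "strong \<delta> {} N" "finite A" "A \<subseteq> N"
  obtains B where "A \<subseteq> B" "strong \<delta> B N"
proof -
  obtain B where B: "finite B" "A \<subseteq> B" "B \<subseteq> N"
    "\<forall>X. finite X \<and> A \<subseteq> X \<and> X \<subseteq> N \<longrightarrow> \<delta> B \<le> \<delta> X"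
    using minimal_superset[OF assms] by blast
  then have "strong \<delta> B N" unfolding strong_def by (simp add: order_trans[OF B(2)])
  with B(2) show ?thesis by (rule that)
qed

text \<open>The dimension is a least element of a set of integers, so it is only meaningful when the
  predimension is bounded below; strength of the empty set provides the bound.\<close>

lemma dimension_attained:
  assumes "strong \<delta> {} N" "finite A" "A \<subseteq> N"
  shows "\<exists>B. finite B \<and> A \<subseteq> B \<and> B \<subseteq> N \<and> dimension \<delta> N A = \<delta> B \<and>
    (\<forall>X. finite X \<and> A \<subseteq> X \<and> X \<subseteq> N \<longrightarrow> \<delta> B \<le> \<delta> X)"
proof -
  obtain B where B: "finite B" "A \<subseteq> B" "B \<subseteq> N"
    "\<forall>X. finite X \<and> A \<subseteq> X \<and> X \<subseteq> N \<longrightarrow> \<delta> B \<le> \<delta> X"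
    using minimal_superset[OF assms] by blast
  then have "dimension \<delta> N A = \<delta> B"
    unfolding dimension_def by (intro Least_equality) blast+
  with B show ?thesis by blast
qed

lemma dimension_le:
  assumes "strong \<delta> {} N" "finite B" "A \<subseteq> B" "B \<subseteq> N"
  shows "dimension \<delta> N A \<le> \<delta> B"
proof -
  have "finite A" "A \<subseteq> N" using assms by (auto intro: rev_finite_subset)
  from dimension_attained[OF assms(1) this]
  obtain C where "dimension \<delta> N A = \<delta> C" "\<forall>X. finite X \<and> A \<subseteq> X \<and> X \<subseteq> N \<longrightarrow> \<delta> C \<le> \<delta> X"
    by auto
  with assms show ?thesis by auto
qed

lemma dimension_mono_predim:
  assumes "strong \<delta> {} N" "strong \<delta>' {} N'" "finite A" "A \<subseteq> N"
    and "\<And>B. finite B \<Longrightarrow> A \<subseteq> B \<Longrightarrow> B \<subseteq> N \<Longrightarrow>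
           \<exists>B'. finite B' \<and> A' \<subseteq> B' \<and> B' \<subseteq> N' \<and> \<delta>' B' \<le> \<delta> B"
  shows "dimension \<delta>' N' A' \<le> dimension \<delta> N A"
proof -
  obtain B where B: "finite B" "A \<subseteq> B" "B \<subseteq> N" "dimension \<delta> N A = \<delta> B"
    using dimension_attained[OF assms(1,3,4)] by blast
  obtain B' where "finite B'" "A' \<subseteq> B'" "B' \<subseteq> N'" "\<delta>' B' \<le> \<delta> B"
    using assms(5)[OF B(1-3)] by auto
  then show ?thesis using dimension_le[OF assms(2), of B' A'] B by simp
qed

lemma dimension_eqI:
  assumes "strong \<delta> {} N" "strong \<delta>' {} N" "finite A" "A \<subseteq> N"
    and "\<And>B. finite B \<Longrightarrow> A \<subseteq> B \<Longrightarrow> B \<subseteq> N \<Longrightarrow> \<exists>B'. finite B' \<and> A \<subseteq> B' \<and> B' \<subseteq> N \<and> \<delta>' B' \<le> \<delta> B"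
    and "\<And>B. finite B \<Longrightarrow> A \<subseteq> B \<Longrightarrow> B \<subseteq> N \<Longrightarrow> \<exists>B'. finite B' \<and> A \<subseteq> B' \<and> B' \<subseteq> N \<and> \<delta> B' \<le> \<delta>' B"
  shows "dimension \<delta> N A = dimension \<delta>' N A"
  using dimension_mono_predim[OF assms(1,2,3,4,5)] dimension_mono_predim[OF assms(2,1,3,4,6)]
  by (rule order.antisym[rotated])

text \<open>By submodularity, cutting a set down to a strong set does not increase its predimension.\<close>

lemma dimension_strong:
  assumes "submodular N \<delta>" "strong \<delta> {} N" "strong \<delta> B N" "A \<subseteq> B"
  shows "dimension \<delta> N A = dimension \<delta> B A"
proof (rule antisym)
  note B = strongD[OF assms(3)]
  have A: "finite A" using B(1) assms(4) by (auto intro: rev_finite_subset)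
  have B0: "strong \<delta> {} B" using strong_subset[OF assms(2)] B by auto
  show "dimension \<delta> N A \<le> dimension \<delta> B A"
    by (rule dimension_mono_predim[OF B0 assms(2) A assms(4)]) (use B in auto)
  show "dimension \<delta> B A \<le> dimension \<delta> N A"
  proof (rule dimension_mono_predim[OF assms(2) B0 A])
    show "A \<subseteq> N" using assms(4) B by auto
    fix X assume X: "finite X" "A \<subseteq> X" "X \<subseteq> N"
    then have "finite (X \<inter> B) \<and> A \<subseteq> X \<inter> B \<and> X \<inter> B \<subseteq> B \<and> \<delta> (X \<inter> B) \<le> \<delta> X"
      using submodular_Int_strong[OF assms(1,3)] assms(4) by auto
    then show "\<exists>B'. finite B' \<and> A \<subseteq> B' \<and> B' \<subseteq> B \<and> \<delta> B' \<le> \<delta> X" ..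
  qed
qed

lemma dimension_image:
  assumes "inj_on h B" "Z \<subseteq> B" "finite B"
  shows "dimension \<delta> (h ` B) (h ` Z) = dimension (\<lambda>Y. \<delta> (h ` Y)) B Z"
proof -
  have "(\<exists>X. finite X \<and> h ` Z \<subseteq> X \<and> X \<subseteq> h ` B \<and> n = \<delta> X) \<longleftrightarrow>
        (\<exists>Y. finite Y \<and> Z \<subseteq> Y \<and> Y \<subseteq> B \<and> n = \<delta> (h ` Y))" for n
  proof
    assume "\<exists>X. finite X \<and> h ` Z \<subseteq> X \<and> X \<subseteq> h ` B \<and> n = \<delta> X"
    then obtain Y where Y: "Y \<subseteq> B" "h ` Z \<subseteq> h ` Y" "n = \<delta> (h ` Y)"
      by (auto simp: subset_image_iff)
    then have "Z \<subseteq> Y" using inj_on_image_mem_iff[OF assms(1)] assms(2) by blast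
    then show "\<exists>Y. finite Y \<and> Z \<subseteq> Y \<and> Y \<subseteq> B \<and> n = \<delta> (h ` Y)"
      using Y assms(3) by (blast intro: rev_finite_subset)
  qed blast
  then show ?thesis unfolding dimension_def by simp
qed

section \<open>Extensions by weighted triples\<close>

definition triple_weight :: "('a set \<Rightarrow> nat) \<Rightarrow> 'a set \<Rightarrow> nat" where
  "triple_weight w Y = (\<Sum>T | T \<subseteq> Y \<and> card T = 3. w T)"

lemma finite_triples: "finite Y \<Longrightarrow> finite {T. T \<subseteq> Y \<and> card T = 3}"
  by (rule finite_subset[of _ "Pow Y"]) auto

lemma triple_weight_empty [simp]: "triple_weight w {} = 0"
  unfolding triple_weight_def by (rule sum.neutral) auto

lemma triple_weight_mono: "finite Y \<Longrightarrow> X \<subseteq> Y \<Longrightarrow> triple_weight w X \<le> triple_weight w Y"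
  unfolding triple_weight_def by (rule sum_mono2[OF finite_triples]) auto

lemma triple_weight_supermodular:
  assumes "finite X" "finite Y"
  shows "triple_weight w X + triple_weight w Y \<le> triple_weight w (X \<union> Y) + triple_weight w (X \<inter> Y)"
proof -
  let ?t = "\<lambda>Y. {T. T \<subseteq> Y \<and> card T = 3}"
  have "triple_weight w X + triple_weight w Y = sum w (?t X \<union> ?t Y) + sum w (?t X \<inter> ?t Y)"
    unfolding triple_weight_def using assms by (intro sum.union_inter[symmetric] finite_triples)
  also have "?t X \<inter> ?t Y = ?t (X \<inter> Y)" by auto
  also have "sum w (?t X \<union> ?t Y) \<le> sum w (?t (X \<union> Y))"
    using assms by (intro sum_mono2 finite_triples) auto
  finally show ?thesis unfolding triple_weight_def by simp
qed

lemma submodular_triple_weight: "submodular N (\<lambda>Y. int (card Y) - int (triple_weight w Y))"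
  unfolding submodular_def
proof safe
  fix X Y :: "'a set" assume "finite X" "finite Y"
  then show "int (card (X \<union> Y)) - int (triple_weight w (X \<union> Y)) + (int (card (X \<inter> Y)) - int (triple_weight w (X \<inter> Y)))
     \<le> int (card X) - int (triple_weight w X) + (int (card Y) - int (triple_weight w Y))"
    using triple_weight_supermodular[of X Y w] card_Un_Int[of X Y] by linarith
qed

lemma triple_weight_image:
  assumes "inj_on g Y"
  shows "triple_weight w (g ` Y) = triple_weight (\<lambda>T. w (g ` T)) Y"
proof -
  have *: "{T. T \<subseteq> g ` Y \<and> card T = 3} = (`) g ` {T. T \<subseteq> Y \<and> card T = 3}"
  proof -
    have "card (g ` T) = card T" if "T \<subseteq> Y" for T
      using that assms by (meson card_image inj_on_subset)
    then show ?thesis by (auto simp: subset_image_iff image_iff)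
  qed
  show ?thesis unfolding triple_weight_def *
    by (rule sum.reindex_cong[OF inj_on_subset[OF inj_on_image_Pow[OF assms]] refl refl]) auto
qed

lemma triple_weight_cong: "(\<And>T. T \<subseteq> Y \<Longrightarrow> card T = 3 \<Longrightarrow> w T = w' T) \<Longrightarrow> triple_weight w Y = triple_weight w' Y"
  unfolding triple_weight_def by (rule sum.cong) auto

text \<open>The predimension of an extension of \<open>A\<close> by new points and weighted triples.\<close>

definition ext_predim :: "('a set \<Rightarrow> int) \<Rightarrow> 'a set \<Rightarrow> ('a set \<Rightarrow> nat) \<Rightarrow> 'a set \<Rightarrow> int" where
  "ext_predim \<delta> A w Y = \<delta> (Y \<inter> A) + int (card (Y - A)) - int (triple_weight w Y)"

text \<open>The extension adds no triple inside \<open>A\<close>, and \<open>A\<close> is strong in it.\<close>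

definition sparse_over :: "'a set \<Rightarrow> ('a set \<Rightarrow> nat) \<Rightarrow> 'a set \<Rightarrow> bool" where
  "sparse_over A w B \<longleftrightarrow> triple_weight w A = 0 \<and> (\<forall>Y. A \<subseteq> Y \<and> Y \<subseteq> B \<longrightarrow> triple_weight w Y \<le> card (Y - A))"

lemma sparse_over_le:
  assumes "sparse_over A w B" "finite B" "A \<subseteq> B" "Y \<subseteq> B"
  shows "triple_weight w Y \<le> card (Y - A)"
proof -
  have "triple_weight w Y \<le> triple_weight w (Y \<union> A)"
    using assms by (intro triple_weight_mono) (auto intro: finite_subset)
  also have "\<dots> \<le> card ((Y \<union> A) - A)"
    using assms unfolding sparse_over_def by auto
  also have "(Y \<union> A) - A = Y - A" by auto
  finally show ?thesis .
qed

lemma strong_empty_ext_predim: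
  assumes "strong \<delta> {} A" "sparse_over A w B" "finite B" "A \<subseteq> B"
  shows "strong (ext_predim \<delta> A w) {} B"
proof -
  have "ext_predim \<delta> A w {} \<le> ext_predim \<delta> A w Y" if "Y \<subseteq> B" for Y
  proof -
    have "finite Y" using that assms by (auto intro: rev_finite_subset)
    then have "\<delta> {} \<le> \<delta> (Y \<inter> A)" using strongD[OF assms(1)] by auto
    then show ?thesis unfolding ext_predim_def using sparse_over_le[OF assms(2-4) that] by simp
  qed
  then show ?thesis unfolding strong_def by auto
qed

lemma strong_ext_predim:
  assumes "sparse_over A w B" "finite B" "A \<subseteq> B"
  shows "strong (ext_predim \<delta> A w) A B"
proof -
  have "ext_predim \<delta> A w A \<le> ext_predim \<delta> A w Y" if Y: "A \<subseteq> Y" "Y \<subseteq> B" for Y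
  proof -
    have "Y \<inter> A = A" using Y by auto
    then show ?thesis
      using sparse_over_le[OF assms Y(2)] assms(1) unfolding ext_predim_def sparse_over_def by simp
  qed
  then show ?thesis using assms finite_subset unfolding strong_def by blast
qed

lemma triple_weight_eq_0D:
  assumes "triple_weight w A = 0" "finite A" "T \<subseteq> A" "card T = 3"
  shows "w T = 0"
  using assms finite_triples[of A] unfolding triple_weight_def by (auto simp: sum_eq_0_iff)

text \<open>For structures on a set containing \<open>A\<close>: a weighting which is old inside \<open>A\<close> and new elsewhere
  contributes the sum of the two parts.\<close>

lemma triple_weight_split:
  assumes "finite Y" "finite A" "triple_weight w A = 0"
  shows "triple_weight (\<lambda>T. if T \<subseteq> A then u T else w T) Y = triple_weight u (Y \<inter> A) + triple_weight w Y"
proof -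
  let ?t = "\<lambda>Y. {T. T \<subseteq> Y \<and> card T = 3}"
  have "triple_weight (\<lambda>T. if T \<subseteq> A then u T else w T) Y
     = (\<Sum>T\<in>?t Y. (if T \<subseteq> A then u T else 0) + w T)"
    unfolding triple_weight_def using triple_weight_eq_0D[OF assms(3,2)] by (intro sum.cong) auto
  also have "\<dots> = (\<Sum>T\<in>?t Y. if T \<subseteq> A then u T else 0) + triple_weight w Y"
    unfolding triple_weight_def by (rule sum.distrib)
  also have "(\<Sum>T\<in>?t Y. if T \<subseteq> A then u T else 0) = (\<Sum>T\<in>{T \<in> ?t Y. T \<subseteq> A}. u T)"
    by (rule sum.inter_filter[symmetric, OF finite_triples[OF assms(1)]])
  also have "{T \<in> ?t Y. T \<subseteq> A} = ?t (Y \<inter> A)" by auto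
  finally show ?thesis unfolding triple_weight_def .
qed

text \<open>A set \<open>Y\<close> may be enlarged inside \<open>A\<close> at will: the number of points outside \<open>A\<close> stays the
  same and the weight of triples only grows.  So in the minimum defining the dimension, \<open>\<delta> (Y \<inter> A)\<close>
  may be replaced by the dimension of \<open>Y \<inter> A\<close> in \<open>A\<close>, on which \<open>\<delta>\<close> and \<open>\<epsilon>\<close> agree.\<close>

lemma dimension_ext_predim_cong:
  assumes "finite B" "A \<subseteq> B" "sparse_over A w B"
    and "strong \<delta> {} A" "strong \<epsilon> {} A"
    and eq: "\<And>Z. Z \<subseteq> A \<Longrightarrow> dimension \<delta> A Z = dimension \<epsilon> A Z"
    and "Z \<subseteq> B"
  shows "dimension (ext_predim \<delta> A w) B Z = dimension (ext_predim \<epsilon> A w) B Z"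
proof -
  have A: "finite A" using assms by (auto intro: rev_finite_subset)
  have half: "\<exists>Y'. finite Y' \<and> Z \<subseteq> Y' \<and> Y' \<subseteq> B \<and> ext_predim \<epsilon> A w Y' \<le> ext_predim \<delta> A w Y"
    if Y: "finite Y" "Z \<subseteq> Y" "Y \<subseteq> B" and A0: "strong \<delta> {} A" "strong \<epsilon> {} A"
      and eq: "\<And>Z. Z \<subseteq> A \<Longrightarrow> dimension \<delta> A Z = dimension \<epsilon> A Z"
    for \<delta> \<epsilon> Y
  proof -
    obtain Y1 where Y1: "Y \<inter> A \<subseteq> Y1" "Y1 \<subseteq> A" "dimension \<epsilon> A (Y \<inter> A) = \<epsilon> Y1"
      using dimension_attained[OF A0(2), of "Y \<inter> A"] A by auto
    have "\<epsilon> Y1 \<le> \<delta> (Y \<inter> A)"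
      using dimension_le[OF A0(1), of "Y \<inter> A" "Y \<inter> A"] Y1 eq[of "Y \<inter> A"] A by auto
    moreover have "(Y \<union> Y1) \<inter> A = Y1" "(Y \<union> Y1) - A = Y - A" using Y1 by auto
    moreover have "triple_weight w Y \<le> triple_weight w (Y \<union> Y1)"
      using Y A Y1 by (intro triple_weight_mono) (auto intro: finite_subset)
    ultimately have "ext_predim \<epsilon> A w (Y \<union> Y1) \<le> ext_predim \<delta> A w Y"
      unfolding ext_predim_def by simp
    moreover have "finite (Y \<union> Y1)" using Y Y1 A by (auto intro: rev_finite_subset)
    ultimately show ?thesis using Y Y1 assms(2) by (intro exI[of _ "Y \<union> Y1"]) auto
  qed
  show ?thesis
  proof (rule dimension_eqI)
    show "strong (ext_predim \<delta> A w) {} B" "strong (ext_predim \<epsilon> A w) {} B"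
      using assms by (auto intro: strong_empty_ext_predim)
    show "finite Z" "Z \<subseteq> B" using assms by (auto intro: rev_finite_subset)
    show "\<exists>Y'. finite Y' \<and> Z \<subseteq> Y' \<and> Y' \<subseteq> B \<and> ext_predim \<epsilon> A w Y' \<le> ext_predim \<delta> A w Y"
      if "finite Y" "Z \<subseteq> Y" "Y \<subseteq> B" for Y
      by (rule half[OF that assms(4,5) eq])
    show "\<exists>Y'. finite Y' \<and> Z \<subseteq> Y' \<and> Y' \<subseteq> B \<and> ext_predim \<delta> A w Y' \<le> ext_predim \<epsilon> A w Y"
      if "finite Y" "Z \<subseteq> Y" "Y \<subseteq> B" for Y
      by (rule half[OF that assms(5,4) eq[symmetric]])
  qed
qed

text \<open>Equality of the predimensions on all subsets of \<open>B\<close> would be too much to ask: a clique and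
  the triples replacing it differ on sets that miss the two chosen points.  It suffices that the
  triples never do better, and catch up after enlarging the set.\<close>

definition triple_resolvable :: "'a set \<Rightarrow> ('a set \<Rightarrow> int) \<Rightarrow> bool" where
  "triple_resolvable N \<delta> \<longleftrightarrow> (\<forall>A B. strong \<delta> A N \<and> strong \<delta> B N \<and> A \<subseteq> B \<longrightarrow>
     (\<exists>w. triple_weight w A = 0 \<and> (\<forall>Y\<subseteq>B. \<delta> Y \<le> ext_predim \<delta> A w Y) \<and>
        (\<forall>Y\<subseteq>B. \<exists>Y'. Y \<subseteq> Y' \<and> Y' \<subseteq> B \<and> ext_predim \<delta> A w Y' \<le> \<delta> Y)))"

text \<open>The extension to be realised lives on an arbitrary type; in the back and forth this is the
  type of the other structure, which is why the type is a parameter.\<close>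

definition triple_rich :: "'c itself \<Rightarrow> 'a set \<Rightarrow> ('a set \<Rightarrow> int) \<Rightarrow> bool" where
  "triple_rich _ N \<delta> \<longleftrightarrow> (\<forall>A (B :: 'c set) w f.
     finite B \<and> A \<subseteq> B \<and> inj_on f A \<and> strong \<delta> (f ` A) N \<and> sparse_over A w B \<longrightarrow>
     (\<exists>g. inj_on g B \<and> (\<forall>a\<in>A. g a = f a) \<and> strong \<delta> (g ` B) N \<and>
        (\<forall>Y\<subseteq>B. \<delta> (g ` Y) = ext_predim (\<lambda>Z. \<delta> (f ` Z)) A w Y)))"

lemma triple_resolvableE:
  assumes "triple_resolvable N \<delta>" "strong \<delta> A N" "strong \<delta> B N" "A \<subseteq> B" "strong \<delta> {} N"
  obtains w where "sparse_over A w B"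
    "\<And>Z. Z \<subseteq> B \<Longrightarrow> dimension \<delta> B Z = dimension (ext_predim \<delta> A w) B Z"
proof -
  obtain w where w: "triple_weight w A = 0" "\<And>Y. Y \<subseteq> B \<Longrightarrow> \<delta> Y \<le> ext_predim \<delta> A w Y"
    "\<And>Y. Y \<subseteq> B \<Longrightarrow> \<exists>Y'. Y \<subseteq> Y' \<and> Y' \<subseteq> B \<and> ext_predim \<delta> A w Y' \<le> \<delta> Y"
    using assms(1)[unfolded triple_resolvable_def, rule_format, OF conjI[OF assms(2) conjI[OF assms(3,4)]]]
    by (elim exE conjE) simp
  note B = strongD[OF assms(3)]
  have "triple_weight w Y \<le> card (Y - A)" if "A \<subseteq> Y" "Y \<subseteq> B" for Y
  proof -
    have "finite Y" using that B by (auto intro: rev_finite_subset)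
    then have "\<delta> A \<le> \<delta> Y" using strongD(3)[OF assms(2)] that B by auto
    also have "\<dots> \<le> ext_predim \<delta> A w Y" using w that by auto
    also have "Y \<inter> A = A" using that by auto
    ultimately show ?thesis unfolding ext_predim_def by simp
  qed
  then have sp: "sparse_over A w B" unfolding sparse_over_def using w by auto
  show ?thesis
  proof (rule that[OF sp])
    fix Z assume Z: "Z \<subseteq> B"
    show "dimension \<delta> B Z = dimension (ext_predim \<delta> A w) B Z"
    proof (rule dimension_eqI)
      show "strong \<delta> {} B" using strong_subset[OF assms(5)] B by auto
      moreover show "strong (ext_predim \<delta> A w) {} B"
        using strong_subset[OF assms(5)] B sp assms(4)
        by (intro strong_empty_ext_predim) auto
      show "finite Z" "Z \<subseteq> B" using Z B by (auto intro: rev_finite_subset)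
      show "\<exists>B'. finite B' \<and> Z \<subseteq> B' \<and> B' \<subseteq> B \<and> ext_predim \<delta> A w B' \<le> \<delta> Ba"
        if "finite Ba" "Z \<subseteq> Ba" "Ba \<subseteq> B" for Ba
        using w(3)[OF that(3)] that B(1) by (meson finite_subset order_trans)
      show "\<exists>B'. finite B' \<and> Z \<subseteq> B' \<and> B' \<subseteq> B \<and> \<delta> B' \<le> ext_predim \<delta> A w Ba"
        if "finite Ba" "Z \<subseteq> Ba" "Ba \<subseteq> B" for Ba
        using w(2)[OF that(3)] that by blast
    qed
  qed
qed

section \<open>Back and forth\<close>

text \<open>Finite approximations are represented by their graphs, so that the two directions are
  exchanged by taking converses.\<close>

lemma back_and_forth:
  fixes I :: "('a \<times> 'b) set set"
  assumes "countable N" "countable N'"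
    and sub: "\<And>p. p \<in> I \<Longrightarrow> p \<subseteq> N \<times> N' \<and> single_valued p \<and> single_valued (p\<inverse>)"
    and "p0 \<in> I"
    and forward: "\<And>p a. p \<in> I \<Longrightarrow> a \<in> N \<Longrightarrow> \<exists>q\<in>I. p \<subseteq> q \<and> a \<in> Domain q"
    and backward: "\<And>p b. p \<in> I \<Longrightarrow> b \<in> N' \<Longrightarrow> \<exists>q\<in>I. p \<subseteq> q \<and> b \<in> Range q"
  shows "\<exists>h. bij_betw h N N' \<and> (\<forall>A. finite A \<and> A \<subseteq> N \<longrightarrow> (\<exists>p\<in>I. \<forall>a\<in>A. (a, h a) \<in> p))"
proof -
  let ?Q = "\<lambda>n p q. p \<subseteq> q \<and> (N \<noteq> {} \<longrightarrow> from_nat_into N n \<in> Domain q) \<and>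
     (N' \<noteq> {} \<longrightarrow> from_nat_into N' n \<in> Range q)"
  have "\<exists>f. \<forall>n. f n \<in> I \<and> ?Q n (f n) (f (Suc n))"
  proof (rule dependent_nat_choice)
    fix p n assume "p \<in> I"
    then obtain q where q: "q \<in> I" "p \<subseteq> q" "N \<noteq> {} \<longrightarrow> from_nat_into N n \<in> Domain q"
      using forward[of p "from_nat_into N n"] from_nat_into[of N n] by blast
    then obtain r where "r \<in> I" "q \<subseteq> r" "N' \<noteq> {} \<longrightarrow> from_nat_into N' n \<in> Range r"
      using backward[of q "from_nat_into N' n"] from_nat_into[of N' n] by blast
    with q show "\<exists>r. r \<in> I \<and> ?Q n p r" by blast
  qed (use \<open>p0 \<in> I\<close> in blast)
  then obtain f where f: "\<forall>n. f n \<in> I \<and> ?Q n (f n) (f (Suc n))" ..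
  then have f: "f n \<in> I" "?Q n (f n) (f (Suc n))" for n by auto
  have mono: "f m \<subseteq> f n" if "m \<le> n" for m n
    using that
  proof (induction rule: dec_induct)
    case (step n)
    then show ?case using f(2)[of n] by auto
  qed simp
  define P where "P = (\<Union>n. f n)"
  have common: "\<exists>n. x \<in> f n \<and> y \<in> f n" if xy: "x \<in> P" "y \<in> P" for x y
  proof -
    obtain m n where "x \<in> f m" "y \<in> f n" using xy unfolding P_def by blast
    then have "x \<in> f (max m n)" "y \<in> f (max m n)"
      using mono[of m "max m n"] mono[of n "max m n"] by auto
    then show ?thesis by blast
  qed
  have dom: "\<exists>b. (a, b) \<in> P" if a: "a \<in> N" for a
  proof -
    obtain n where "from_nat_into N n = a" using from_nat_into_surj[OF assms(1) a] by blast
    then have "a \<in> Domain (f (Suc n))" using f(2)[of n] a by auto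
    then show ?thesis unfolding P_def by blast
  qed
  have ran: "\<exists>a. (a, b) \<in> P" if b: "b \<in> N'" for b
  proof -
    obtain n where "from_nat_into N' n = b" using from_nat_into_surj[OF assms(2) b] by blast
    then have "b \<in> Range (f (Suc n))" using f(2)[of n] b by auto
    then show ?thesis unfolding P_def by blast
  qed
  have sv: "b = c" if "(a, b) \<in> P" "(a, c) \<in> P" for a b c
    using common[OF that] sub f(1) by (meson single_valuedD)
  have vs: "a = c" if "(a, b) \<in> P" "(c, b) \<in> P" for a b c
    using common[OF that] sub f(1) by (meson single_valuedD converseI)
  have PN: "P \<subseteq> N \<times> N'" unfolding P_def using sub f(1) by blast
  define h where "h a = (SOME b. (a, b) \<in> P)" for a
  have h: "(a, h a) \<in> P" if "a \<in> N" for a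
    unfolding h_def using dom[OF that] by (rule someI_ex)
  have "bij_betw h N N'"
    unfolding bij_betw_def
  proof (intro conjI subset_antisym subsetI)
    show "inj_on h N" by (rule inj_onI) (metis h vs)
    show "b \<in> N'" if "b \<in> h ` N" for b using that h PN by blast
    show "b \<in> h ` N" if "b \<in> N'" for b
    proof -
      obtain a where a: "(a, b) \<in> P" using ran \<open>b \<in> N'\<close> by blast
      then have "a \<in> N" using PN by blast
      then show ?thesis using sv[OF a h] by blast
    qed
  qed
  moreover have "\<exists>p\<in>I. \<forall>a\<in>A. (a, h a) \<in> p" if "finite A" "A \<subseteq> N" for A
  proof -
    have "\<forall>a\<in>A. \<exists>n. (a, h a) \<in> f n" using h that unfolding P_def by blast
    then obtain k where k: "\<forall>a\<in>A. (a, h a) \<in> f (k a)" by metis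
    have "k a \<le> Max (k ` A)" if "a \<in> A" for a using that \<open>finite A\<close> by auto
    then have "\<forall>a\<in>A. (a, h a) \<in> f (Max (k ` A))" using k mono by blast
    then show ?thesis using f(1) by blast
  qed
  ultimately show ?thesis by auto
qed

definition partial_isos ::
  "'a set \<Rightarrow> ('a set \<Rightarrow> int) \<Rightarrow> 'b set \<Rightarrow> ('b set \<Rightarrow> int) \<Rightarrow> ('a \<times> 'b) set set" where
  "partial_isos N \<delta> N' \<delta>' = {(\<lambda>a. (a, h a)) ` A | A h.
     strong \<delta> A N \<and> inj_on h A \<and> strong \<delta>' (h ` A) N' \<and>
     (\<forall>Z\<subseteq>A. dimension \<delta> A Z = dimension \<delta>' (h ` A) (h ` Z))}"

lemma partial_isos_converse:
  assumes "p \<in> partial_isos N \<delta> N' \<delta>'"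
  shows "p\<inverse> \<in> partial_isos N' \<delta>' N \<delta>"
proof -
  obtain A h where p: "p = (\<lambda>a. (a, h a)) ` A" "strong \<delta> A N" "inj_on h A"
    "strong \<delta>' (h ` A) N'" "\<And>Z. Z \<subseteq> A \<Longrightarrow> dimension \<delta> A Z = dimension \<delta>' (h ` A) (h ` Z)"
    using assms unfolding partial_isos_def by blast
  let ?k = "inv_into A h"
  have k: "?k ` h ` Z = Z" if "Z \<subseteq> A" for Z
    using p(3) that by (force simp: image_image inv_into_f_f subset_iff)
  have "p\<inverse> = (\<lambda>b. (b, ?k b)) ` (h ` A)"
    using p(3) by (force simp: p(1))
  moreover have "strong \<delta> (?k ` (h ` A)) N" using p(2) k[of A] by simp
  moreover have "inj_on ?k (h ` A)" by (simp add: inj_on_inv_into)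
  moreover have "dimension \<delta>' (h ` A) Z = dimension \<delta> (?k ` (h ` A)) (?k ` Z)" if Z: "Z \<subseteq> h ` A" for Z
  proof -
    obtain Y where Y: "Y \<subseteq> A" "Z = h ` Y" using Z by (auto simp: subset_image_iff)
    show ?thesis using p(5)[OF Y(1)] k[OF Y(1)] k[of A] Y(2) by simp
  qed
  ultimately show ?thesis using p(4) unfolding partial_isos_def by blast
qed

text \<open>The new strong set \<open>B\<close> is resolved into weighted triples over \<open>A\<close>, the same triples are
  realised over \<open>h ` A\<close>, and the dimensions agree because they agree on \<open>A\<close>.\<close>

lemma partial_isos_forth:
  fixes N :: "'a set" and N' :: "'b set"
  assumes "strong \<delta> {} N" "submodular N \<delta>" "triple_resolvable N \<delta>"
    and "strong \<delta>' {} N'" "submodular N' \<delta>'" "triple_rich TYPE('a) N' \<delta>'"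
    and "p \<in> partial_isos N \<delta> N' \<delta>'" "b \<in> N"
  shows "\<exists>q \<in> partial_isos N \<delta> N' \<delta>'. p \<subseteq> q \<and> b \<in> Domain q"
proof -
  obtain A h where p: "p = (\<lambda>a. (a, h a)) ` A" "strong \<delta> A N" "inj_on h A"
    "strong \<delta>' (h ` A) N'" "\<And>Z. Z \<subseteq> A \<Longrightarrow> dimension \<delta> A Z = dimension \<delta>' (h ` A) (h ` Z)"
    using assms unfolding partial_isos_def by blast
  obtain B where B: "insert b A \<subseteq> B" "strong \<delta> B N"
    using strong_superset[OF assms(1), of "insert b A"] strongD[OF p(2)] assms(8) by auto
  obtain w where w: "sparse_over A w B"
    "\<And>Z. Z \<subseteq> B \<Longrightarrow> dimension \<delta> B Z = dimension (ext_predim \<delta> A w) B Z"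
    using triple_resolvableE[OF assms(3) p(2) B(2) _ assms(1)] B(1) by auto
  have fin: "finite B" "A \<subseteq> B" using strongD[OF B(2)] B by auto
  have "finite B \<and> A \<subseteq> B \<and> inj_on h A \<and> strong \<delta>' (h ` A) N' \<and> sparse_over A w B"
    using fin p(3,4) w(1) by simp
  from assms(6)[unfolded triple_rich_def, rule_format, OF this]
  obtain g where g: "inj_on g B" "\<forall>a\<in>A. g a = h a" "strong \<delta>' (g ` B) N'"
    "\<And>Y. Y \<subseteq> B \<Longrightarrow> \<delta>' (g ` Y) = ext_predim (\<lambda>Z. \<delta>' (h ` Z)) A w Y"
    by (elim exE conjE) simp
  have A0: "strong \<delta> {} A" using strong_subset[OF assms(1)] strongD[OF p(2)] by auto
  have hA0: "strong (\<lambda>Z. \<delta>' (h ` Z)) {} A"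
    using strongD[OF assms(4)] strongD[OF p(4)] unfolding strong_def by (auto simp: image_subset_iff)
  have hdim: "dimension \<delta> A Z = dimension (\<lambda>Z. \<delta>' (h ` Z)) A Z" if "Z \<subseteq> A" for Z
    using p(5)[OF that] dimension_image[OF p(3) that] strongD(1)[OF p(2)] by simp
  have "dimension \<delta> B Z = dimension \<delta>' (g ` B) (g ` Z)" if Z: "Z \<subseteq> B" for Z
  proof -
    have "dimension \<delta> B Z = dimension (ext_predim \<delta> A w) B Z" using w Z by blast
    also have "\<dots> = dimension (ext_predim (\<lambda>Z. \<delta>' (h ` Z)) A w) B Z"
      using dimension_ext_predim_cong[OF fin w(1) A0 hA0 hdim Z] by blast
    also have "\<dots> = dimension (\<lambda>Y. \<delta>' (g ` Y)) B Z"
    proof -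
      have "(\<exists>Y. finite Y \<and> Z \<subseteq> Y \<and> Y \<subseteq> B \<and> n = ext_predim (\<lambda>Z. \<delta>' (h ` Z)) A w Y) \<longleftrightarrow>
            (\<exists>Y. finite Y \<and> Z \<subseteq> Y \<and> Y \<subseteq> B \<and> n = \<delta>' (g ` Y))" for n
        using g(4) by metis
      then show ?thesis unfolding dimension_def by simp
    qed
    also have "\<dots> = dimension \<delta>' (g ` B) (g ` Z)"
      using dimension_image[OF g(1) Z fin(1)] by simp
    finally show ?thesis .
  qed
  then have "(\<lambda>a. (a, g a)) ` B \<in> partial_isos N \<delta> N' \<delta>'"
    using B(2) g(1,3) unfolding partial_isos_def by blast
  moreover have "p \<subseteq> (\<lambda>a. (a, g a)) ` B" using p(1) fin(2) g(2) by (auto simp: image_iff)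
  moreover have "b \<in> Domain ((\<lambda>a. (a, g a)) ` B)" using B(1) by force
  ultimately show ?thesis by blast
qed

theorem pregeometry_isomorphic_triple_geometries:
  fixes N :: "'a set" and N' :: "'b set"
  assumes "countable N" "strong \<delta> {} N" "submodular N \<delta>" "triple_resolvable N \<delta>"
      "triple_rich TYPE('b) N \<delta>"
    and "countable N'" "strong \<delta>' {} N'" "submodular N' \<delta>'" "triple_resolvable N' \<delta>'"
      "triple_rich TYPE('a) N' \<delta>'"
    and "\<delta> {} = \<delta>' {}"
  shows "pregeometry_isomorphic N (dimension \<delta> N) N' (dimension \<delta>' N')"
proof -
  let ?I = "partial_isos N \<delta> N' \<delta>'"
  have "\<exists>h. bij_betw h N N' \<and> (\<forall>A. finite A \<and> A \<subseteq> N \<longrightarrow> (\<exists>p\<in>?I. \<forall>a\<in>A. (a, h a) \<in> p))"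
  proof (rule back_and_forth[OF assms(1,6), of ?I "{}"])
    show "p \<subseteq> N \<times> N' \<and> single_valued p \<and> single_valued (p\<inverse>)" if "p \<in> ?I" for p
      using that unfolding partial_isos_def strong_def
      by (auto simp: single_valued_def inj_on_def)
    have "dimension \<delta> {} {} = dimension \<delta>' {} {}"
      using assms(11) unfolding dimension_def by simp
    then show "{} \<in> ?I"
      using assms(2,7) unfolding partial_isos_def by auto
    show "\<exists>q\<in>?I. p \<subseteq> q \<and> a \<in> Domain q" if "p \<in> ?I" "a \<in> N" for p a
      using partial_isos_forth[OF assms(2,3,4,7,8,10) that] .
    show "\<exists>q\<in>?I. p \<subseteq> q \<and> b \<in> Range q" if pb: "p \<in> ?I" "b \<in> N'" for p b
    proof -
      obtain q where q: "q \<in> partial_isos N' \<delta>' N \<delta>" "p\<inverse> \<subseteq> q" "b \<in> Domain q"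
        using partial_isos_forth[OF assms(7,8,9,2,3,5) partial_isos_converse[OF pb(1)] pb(2)]
        by blast
      have "q\<inverse> \<in> ?I" using partial_isos_converse[OF q(1)] .
      then show ?thesis by (rule rev_bexI) (use q(2,3) in auto)
    qed
  qed
  then obtain h where h: "bij_betw h N N'"
    "\<And>A. finite A \<Longrightarrow> A \<subseteq> N \<Longrightarrow> \<exists>p\<in>?I. \<forall>a\<in>A. (a, h a) \<in> p"
    by (elim exE conjE) simp
  have "independent (dimension \<delta> N) Z \<longleftrightarrow> independent (dimension \<delta>' N') (h ` Z)"
    if Z: "finite Z" "Z \<subseteq> N" for Z
  proof -
    obtain p where p: "p \<in> ?I" "\<forall>a\<in>Z. (a, h a) \<in> p" using h(2) Z by blast
    obtain A k where k: "p = (\<lambda>a. (a, k a)) ` A" "strong \<delta> A N" "inj_on k A"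
      "strong \<delta>' (k ` A) N'" "\<And>Z. Z \<subseteq> A \<Longrightarrow> dimension \<delta> A Z = dimension \<delta>' (k ` A) (k ` Z)"
      using p(1) unfolding partial_isos_def by blast
    have ZA: "Z \<subseteq> A" "h ` Z = k ` Z" using p(2) k(1) by (auto simp: image_iff)
    have "dimension \<delta> N Z = dimension \<delta> A Z"
      using dimension_strong[OF assms(3,2) k(2) ZA(1)] .
    also have "\<dots> = dimension \<delta>' (k ` A) (k ` Z)" using k(5)[OF ZA(1)] .
    also have "\<dots> = dimension \<delta>' N' (k ` Z)"
      using dimension_strong[OF assms(8,7) k(4), of "k ` Z"] ZA(1) by (simp add: image_mono)
    finally have "dimension \<delta> N Z = dimension \<delta>' N' (h ` Z)" using ZA by simp
    moreover have "card (h ` Z) = card Z"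
      using h(1) Z(2) by (meson bij_betw_imp_inj_on card_image inj_on_subset)
    ultimately show ?thesis unfolding independent_def by simp
  qed
  then show ?thesis unfolding pregeometry_isomorphic_def using h(1) by blast
qed

section \<open>Realising finite strong extensions in a generic structure\<close>

lemma generic_structure_basic:
  assumes "generic_structure str \<delta> str' \<delta>' M R"
  shows "countable M" "str M R" "strong (\<delta> R) {} M"
proof -
  show "countable M" using assms unfolding generic_structure_def by (elim conjE)
  show "str M R" using assms unfolding generic_structure_def by (elim conjE)
  have *: "\<forall>A. finite A \<and> A \<subseteq> M \<longrightarrow> strong (\<delta> R) {} A"
    using assms unfolding generic_structure_def by (elim conjE)
  have "\<delta> R {} \<le> \<delta> R B" if "finite B" "B \<subseteq> M" for B
    using * that strongD(3)[of "\<delta> R" "{}" B B] by simp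
  then show "strong (\<delta> R) {} M" unfolding strong_def by simp
qed

definition map_rel3 :: "('a \<Rightarrow> 'b) \<Rightarrow> 'a rel3 \<Rightarrow> 'b rel3" where
  "map_rel3 e S = (\<lambda>(x, y, z). (e x, e y, e z)) ` S"

lemma embedding_map_rel3:
  assumes "inj_on e B" "S \<subseteq> B \<times> B \<times> B"
  shows "embedding e B S (e ` B) (map_rel3 e S)"
proof -
  have "(x, y, z) \<in> S" if "x \<in> B" "y \<in> B" "z \<in> B" "(e x, e y, e z) \<in> map_rel3 e S" for x y z
  proof -
    obtain x' y' z' where *: "(x', y', z') \<in> S" "e x = e x'" "e y = e y'" "e z = e z'"
      using \<open>_ \<in> map_rel3 e S\<close> unfolding map_rel3_def by auto
    then have "x' \<in> B" "y' \<in> B" "z' \<in> B" using assms(2) by auto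
    then have "x = x'" "y = y'" "z = z'" using * that(1-3) inj_onD[OF assms(1)] by metis+
    then show ?thesis using * by simp
  qed
  moreover have "(e x, e y, e z) \<in> map_rel3 e S" if "(x, y, z) \<in> S" for x y z
    unfolding map_rel3_def using that by (rule rev_image_eqI) simp
  ultimately show ?thesis unfolding embedding_def using assms(1) by blast
qed

lemma embeddingD:
  assumes "embedding g B S M R"
  shows "inj_on g B" "g ` B \<subseteq> M"
    "\<And>x y z. x \<in> B \<Longrightarrow> y \<in> B \<Longrightarrow> z \<in> B \<Longrightarrow> (g x, g y, g z) \<in> R \<longleftrightarrow> (x, y, z) \<in> S"
  using assms unfolding embedding_def by auto

text \<open>Genericity is phrased with extensions on natural numbers.  Here the extension \<open>B\<close> of the
  strong set \<open>f ` A\<close> may live on any type; it is moved along an injection into the natural numbers,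
  under which structure and predimension must be invariant.\<close>

lemma generic_structure_extend:
  fixes B :: "'c set"
  assumes gen: "generic_structure str \<delta> str' \<delta>' M R"
    and B: "finite B" "A \<subseteq> B" "S \<subseteq> B \<times> B \<times> B"
    and f: "inj_on f A" "strong (\<delta> R) (f ` A) M"
      "\<And>x y z. x \<in> A \<Longrightarrow> y \<in> A \<Longrightarrow> z \<in> A \<Longrightarrow> (x, y, z) \<in> S \<longleftrightarrow> (f x, f y, f z) \<in> R"
    and eps: "strong \<epsilon> {} B" "strong \<epsilon> A B"
    and str: "\<And>e. inj_on e B \<Longrightarrow> str' (e ` B) (map_rel3 e S)"
    and pre: "\<And>e Y. embedding e B S (e ` B) (map_rel3 e S) \<Longrightarrow> Y \<subseteq> B \<Longrightarrow>
                \<delta>' (map_rel3 e S) (e ` Y) = \<epsilon> Y"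
  shows "\<exists>g. embedding g B S M R \<and> (\<forall>a\<in>A. g a = f a) \<and> strong (\<delta> R) (g ` B) M"
proof -
  obtain e :: "'c \<Rightarrow> nat" where e: "inj_on e B"
    using finite_imp_inj_to_nat_seg[OF B(1)] by blast
  let ?S = "map_rel3 e S" and ?k = "\<lambda>b. e (inv_into A f b)"
  note emb = embedding_map_rel3[OF e B(3)]
  have strong_image: "strong (\<delta>' ?S) (e ` Z) (e ` B)" if Z: "strong \<epsilon> Z B" for Z
  proof -
    have "\<delta>' ?S (e ` Z) \<le> \<delta>' ?S X" if X: "e ` Z \<subseteq> X" "X \<subseteq> e ` B" for X
    proof -
      obtain Y where Y: "Y \<subseteq> B" "X = e ` Y" using X(2) by (auto simp: subset_image_iff)
      have ZB: "Z \<subseteq> B" using strongD[OF Z] by simp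
      have "Z \<subseteq> Y" using X(1) Y ZB inj_on_image_mem_iff[OF e] by blast
      then have "\<epsilon> Z \<le> \<epsilon> Y" using strongD[OF Z] Y finite_subset[OF Y(1) B(1)] by simp
      then show ?thesis using pre[OF emb Y(1)] pre[OF emb ZB] Y(2) by simp
    qed
    then show ?thesis using strongD[OF Z] unfolding strong_def by auto
  qed
  have kA: "?k ` (f ` A) = e ` A" using f(1) by (force simp: image_image)
  have "embedding ?k (f ` A) R (e ` B) ?S"
    unfolding embedding_def
  proof (intro conjI ballI)
    show "inj_on ?k (f ` A)"
      using inj_on_subset[OF e B(2)] f(1) by (auto simp: inj_on_def)
    show "?k ` (f ` A) \<subseteq> e ` B" using kA B(2) by auto
    fix x y z assume "x \<in> f ` A" "y \<in> f ` A" "z \<in> f ` A"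
    then obtain a b c where "a \<in> A" "b \<in> A" "c \<in> A" "x = f a" "y = f b" "z = f c" by blast
    then show "((x, y, z) \<in> R) = ((?k x, ?k y, ?k z) \<in> ?S)"
      using f(3)[of a b c] embeddingD(3)[OF emb, of a b c] B(2) f(1) by auto
  qed
  moreover have "strong (\<delta>' ?S) {} (e ` B)" using strong_image[OF eps(1)] by simp
  moreover have "strong (\<delta>' ?S) (?k ` (f ` A)) (e ` B)" using strong_image[OF eps(2)] kA by simp
  moreover have "finite (e ` B)" using B(1) by simp
  ultimately have "\<exists>g. embedding g (e ` B) ?S M R \<and> (\<forall>a\<in>f ` A. g (?k a) = a) \<and> strong (\<delta> R) (g ` (e ` B)) M"
    using gen[unfolded generic_structure_def] f(2) str[OF e] by (elim conjE) blast
  then obtain g where g: "embedding g (e ` B) ?S M R" "\<forall>a\<in>f ` A. g (?k a) = a"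
      "strong (\<delta> R) (g ` (e ` B)) M"
    by (elim exE conjE)
  show ?thesis
  proof (intro exI[of _ "g \<circ> e"] conjI ballI)
    show "embedding (g \<circ> e) B S M R"
      unfolding embedding_def
      using embeddingD[OF g(1)] embeddingD[OF emb] comp_inj_on[OF e, of g] by auto
    show "(g \<circ> e) a = f a" if "a \<in> A" for a using g(2) that f(1) by force
    show "strong (\<delta> R) ((g \<circ> e) ` B) M" using g(3) by (simp add: image_comp)
  qed
qed

section \<open>The structure with an arbitrary ternary relation\<close>

text \<open>Counting relations by their underlying triples turns the predimension into one given by
  weights.\<close>

definition mult :: "'a rel3 \<Rightarrow> 'a set \<Rightarrow> nat" where
  "mult R T = card {(x, y, z). (x, y, z) \<in> R \<and> {x, y, z} = T}"

lemma finite_orderings: "finite T \<Longrightarrow> finite {(x, y, z). P x y z \<and> {x, y, z} = T}"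
  by (rule finite_subset[of _ "T \<times> T \<times> T"]) auto

lemma distinct_of_card_3: "card {x, y, z} = 3 \<Longrightarrow> x \<noteq> y \<and> x \<noteq> z \<and> y \<noteq> z"
  by (auto simp: card_insert_if split: if_splits)

lemma card_orderings:
  assumes "card T = 3"
  shows "3 \<le> card {(x, y, z). {x, y, z} = T}"
proof -
  obtain a b c where abc: "T = {a, b, c}" "a \<noteq> b" "a \<noteq> c" "b \<noteq> c"
    using assms card_3_iff by metis
  have "3 = card {(a, b, c), (b, c, a), (c, a, b)}" using abc by simp
  also have "\<dots> \<le> card {(x, y, z). {x, y, z} = T}"
    using finite_orderings[of T "\<lambda>_ _ _. True"] abc by (intro card_mono) auto
  finally show ?thesis .
qed

lemma predim_eq_triple_weight:
  assumes "ternary_structure N R" "finite Y"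
  shows "predim R Y = int (card Y) - int (triple_weight (mult R) Y)"
proof -
  let ?I = "{T. T \<subseteq> Y \<and> card T = 3}"
  let ?O = "\<lambda>T. {(x, y, z). (x, y, z) \<in> R \<and> {x, y, z} = T}"
  have c3: "card {x, y, z} = 3" if "(x, y, z) \<in> R" for x y z
    using assms(1) that unfolding ternary_structure_def by fastforce
  have "R \<inter> Y \<times> Y \<times> Y = (\<Union>T\<in>?I. ?O T)"
    using c3 by auto
  moreover have "card (\<Union>T\<in>?I. ?O T) = (\<Sum>T\<in>?I. card (?O T))"
  proof (rule card_UN_disjoint)
    show "finite ?I" by (rule finite_triples[OF assms(2)])
    show "\<forall>T\<in>?I. finite (?O T)"
      using finite_orderings[of _ "\<lambda>x y z. (x, y, z) \<in> R"] finite_subset[OF _ assms(2)] by auto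
  qed auto
  ultimately show ?thesis unfolding predim_def triple_weight_def mult_def by simp
qed

lemma mult_embedding:
  assumes "embedding g B S M R" "T \<subseteq> B"
  shows "mult R (g ` T) = mult S T"
proof -
  note g = embeddingD[OF assms(1)]
  let ?h = "\<lambda>(x, y, z). (g x, g y, g z)"
  have "{(x, y, z). (x, y, z) \<in> R \<and> {x, y, z} = g ` T} = ?h ` {(x, y, z). (x, y, z) \<in> S \<and> {x, y, z} = T}"
    (is "?L = ?h ` ?K")
  proof (intro subset_antisym subsetI)
    fix t assume t: "t \<in> ?L"
    obtain u v w where uvw: "t = (u, v, w)" "(u, v, w) \<in> R" "{u, v, w} = g ` T" using t by auto
    have "u \<in> g ` T" "v \<in> g ` T" "w \<in> g ` T" unfolding uvw(3)[symmetric] by simp_all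
    then obtain x y z where xyz: "x \<in> T" "y \<in> T" "z \<in> T" "u = g x" "v = g y" "w = g z"
      by (elim imageE)
    then have "g ` {x, y, z} = g ` T" using uvw by simp
    then have "{x, y, z} = T"
      using inj_on_image_eq_iff[OF g(1), of "{x, y, z}" T] xyz assms(2) by auto
    moreover have "(x, y, z) \<in> S" using g(3)[of x y z] xyz uvw assms(2) by auto
    ultimately have "(x, y, z) \<in> ?K" by simp
    then show "t \<in> ?h ` ?K" by (rule rev_image_eqI) (use uvw xyz in simp)
  next
    fix t assume "t \<in> ?h ` ?K"
    then obtain x y z where "(x, y, z) \<in> S" "{x, y, z} = T" "t = (g x, g y, g z)" by auto
    then show "t \<in> ?L" using g(3)[of x y z] assms(2) by auto
  qed
  moreover have "inj_on ?h ?K"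
    using g(1) assms(2) by (auto simp: inj_on_def subset_iff) 
  ultimately show ?thesis unfolding mult_def by (simp add: card_image)
qed

lemma predim_embedding:
  assumes "embedding g B S M R" "ternary_structure M R" "ternary_structure B S" "Y \<subseteq> B" "finite Y"
  shows "predim R (g ` Y) = predim S Y"
proof -
  have inj: "inj_on g Y" using embeddingD(1)[OF assms(1)] assms(4) inj_on_subset by blast
  have "triple_weight (mult R) (g ` Y) = triple_weight (mult S) Y"
    unfolding triple_weight_image[OF inj] using mult_embedding[OF assms(1)] assms(4)
    by (intro triple_weight_cong) auto
  then show ?thesis
    using predim_eq_triple_weight[OF assms(2)] predim_eq_triple_weight[OF assms(3)] assms(5) card_image[OF inj] by simp
qed

lemma ternary_structure_map_rel3:
  assumes "ternary_structure B S" "inj_on e B"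
  shows "ternary_structure (e ` B) (map_rel3 e S)"
  using assms unfolding ternary_structure_def map_rel3_def by (fastforce simp: inj_on_eq_iff)

lemma predim_split:
  assumes "ternary_structure N R" "finite Y" "finite A"
    and "triple_weight w A = 0"
    and "\<And>T. T \<subseteq> Y \<Longrightarrow> card T = 3 \<Longrightarrow> mult R T = (if T \<subseteq> A then u T else w T)"
  shows "predim R Y = ext_predim (\<lambda>Z. int (card Z) - int (triple_weight u Z)) A w Y"
proof -
  have "triple_weight (mult R) Y = triple_weight u (Y \<inter> A) + triple_weight w Y"
    using triple_weight_cong[of Y "mult R", OF assms(5)] triple_weight_split[OF assms(2,3,4)] by simp
  moreover have "card Y = card (Y \<inter> A) + card (Y - A)"
    using card_Int_Diff[OF assms(2)] .
  ultimately show ?thesis using predim_eq_triple_weight[OF assms(1,2)] unfolding ext_predim_def by simp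
qed

lemma triple_resolvable_predim:
  assumes "ternary_structure M R"
  shows "triple_resolvable M (predim R)"
  unfolding triple_resolvable_def
proof (intro allI impI)
  fix A B assume AB: "strong (predim R) A M \<and> strong (predim R) B M \<and> A \<subseteq> B"
  then have fin: "finite A" "finite B" by (auto simp: strong_def)
  let ?w = "\<lambda>T. if T \<subseteq> A then 0 else mult R T"
  have w: "triple_weight ?w A = 0" unfolding triple_weight_def by (rule sum.neutral) auto
  have eq: "predim R Y = ext_predim (predim R) A ?w Y" if "Y \<subseteq> B" for Y
  proof -
    have Y: "finite Y" using that fin finite_subset by blast
    have "predim R Y = ext_predim (\<lambda>Z. int (card Z) - int (triple_weight (mult R) Z)) A ?w Y"
      by (rule predim_split[OF assms Y fin(1) w]) simp
    then show ?thesis using predim_eq_triple_weight[OF assms, of "Y \<inter> A"] Y unfolding ext_predim_def by simp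
  qed
  show "\<exists>w. triple_weight w A = 0 \<and> (\<forall>Y\<subseteq>B. predim R Y \<le> ext_predim (predim R) A w Y) \<and>
      (\<forall>Y\<subseteq>B. \<exists>Y'. Y \<subseteq> Y' \<and> Y' \<subseteq> B \<and> ext_predim (predim R) A w Y' \<le> predim R Y)"
    using w eq by (intro exI[of _ ?w]) auto
qed

text \<open>On every triple \<open>T\<close>, as many orderings are put into the relation as the weight demands; there are
  enough of them because \<open>w T \<le> |T - A| \<le> 3\<close>.\<close>

lemma triple_rich_predim:
  assumes "hrushovski_structure M R"
  shows "triple_rich TYPE('c) M (predim R)"
  unfolding triple_rich_def
proof (intro allI impI)
  fix A B :: "'c set" and w f
  assume *: "finite B \<and> A \<subseteq> B \<and> inj_on f A \<and> strong (predim R) (f ` A) M \<and> sparse_over A w B"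
  then have B: "finite B" "A \<subseteq> B" and A: "finite A" and f: "inj_on f A" "strong (predim R) (f ` A) M"
    and w: "sparse_over A w B" by (auto intro: finite_subset)
  note gen = assms[unfolded hrushovski_structure_def]
  note tM = generic_structure_basic(2)[OF gen] and M0 = generic_structure_basic(3)[OF gen]
  have w0: "triple_weight w A = 0" using w unfolding sparse_over_def by simp
  have w3: "w T \<le> 3" if T: "T \<subseteq> B" "card T = 3" for T
  proof -
    have fT: "finite T" using T card.infinite by fastforce
    have "w T \<le> triple_weight w T"
      unfolding triple_weight_def using T finite_triples[OF fT] by (intro member_le_sum) auto
    also have "\<dots> \<le> card (T - A)" using sparse_over_le[OF w B T(1)] .
    also have "\<dots> \<le> 3" using card_mono[OF fT, of "T - A"] T(2) by auto
    finally show ?thesis .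
  qed
  let ?ord = "\<lambda>T. {(x, y, z). {x, y, z} = T}"
  have "\<exists>s. T \<subseteq> B \<and> card T = 3 \<longrightarrow> s \<subseteq> ?ord T \<and> card s = w T" for T
    using obtain_subset_with_card_n[of "w T" "?ord T"] w3[of T] card_orderings[of T]
    by (metis (no_types, lifting) le_trans)
  then obtain s where s: "\<And>T. T \<subseteq> B \<Longrightarrow> card T = 3 \<Longrightarrow> s T \<subseteq> ?ord T \<and> card (s T) = w T"
    by metis
  define S where "S = {(x, y, z). x \<in> A \<and> y \<in> A \<and> z \<in> A \<and> (f x, f y, f z) \<in> R} \<union>
     (\<Union>T\<in>{T. T \<subseteq> B \<and> card T = 3}. s T)"
  have distR: "x \<noteq> y \<and> x \<noteq> z \<and> y \<noteq> z" if "(f x, f y, f z) \<in> R" for x y z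
    using tM that unfolding ternary_structure_def by blast
  have fin3: "finite T" if "card T = 3" for T :: "'c set"
    using that card.infinite by fastforce
  have s_sub: "s T = {(x, y, z). (x, y, z) \<in> s T \<and> {x, y, z} = T}" if "T \<subseteq> B" "card T = 3" for T
    using s[OF that] by auto
  have s0: "s T = {}" if "T \<subseteq> A" "card T = 3" for T
  proof -
    have TB: "T \<subseteq> B" using that B(2) by auto
    have "card (s T) = 0" using s[OF TB that(2)] triple_weight_eq_0D[OF w0 A that] by simp
    moreover have "finite (s T)"
      using s[OF TB that(2)] finite_orderings[OF fin3[OF that(2)], of "\<lambda>_ _ _. True"]
      by (auto intro: finite_subset)
    ultimately show ?thesis by simp
  qed
  have in_s: "{x, y, z} = T" if "(x, y, z) \<in> s T" "T \<subseteq> B" "card T = 3" for x y z T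
    using s[OF that(2,3)] that(1) by auto
  have SB: "S \<subseteq> B \<times> B \<times> B"
    unfolding S_def using B(2) in_s by fastforce
  have tS: "ternary_structure B S"
  proof -
    have "x \<noteq> y \<and> x \<noteq> z \<and> y \<noteq> z" if xyz: "(x, y, z) \<in> S" for x y z
      using xyz unfolding S_def
    proof
      assume "(x, y, z) \<in> {(x, y, z). x \<in> A \<and> y \<in> A \<and> z \<in> A \<and> (f x, f y, f z) \<in> R}"
      then show ?thesis using distR[of x y z] by simp
    next
      assume "(x, y, z) \<in> (\<Union>T\<in>{T. T \<subseteq> B \<and> card T = 3}. s T)"
      then obtain T where T: "T \<subseteq> B" "card T = 3" "(x, y, z) \<in> s T" by auto
      then show ?thesis using in_s[OF T(3,1,2)] distinct_of_card_3[of x y z] by simp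
    qed
    then show ?thesis using SB unfolding ternary_structure_def by auto
  qed
  have SA: "(x, y, z) \<in> S \<longleftrightarrow> (f x, f y, f z) \<in> R" if "x \<in> A" "y \<in> A" "z \<in> A" for x y z
  proof -
    have "(x, y, z) \<notin> s T" if T: "T \<subseteq> B" "card T = 3" for T
    proof
      assume m: "(x, y, z) \<in> s T"
      then have "T \<subseteq> A" using in_s[OF m T] \<open>x \<in> A\<close> \<open>y \<in> A\<close> \<open>z \<in> A\<close> by auto
      then show False using s0[OF _ T(2)] m by auto
    qed
    then show ?thesis unfolding S_def using that by auto
  qed
  have mult: "mult S T = (if T \<subseteq> A then mult R (f ` T) else w T)" if T: "T \<subseteq> B" "card T = 3" for T
  proof (cases "T \<subseteq> A")
    case True
    have "embedding f A S M R"
      unfolding embedding_def using f SA strongD(2)[OF f(2)] by auto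
    from mult_embedding[OF this True] show ?thesis using True by simp
  next
    case False
    have "{(x, y, z). (x, y, z) \<in> S \<and> {x, y, z} = T} = s T"
      using False in_s T unfolding S_def by auto
    then show ?thesis unfolding mult_def using s[OF T] False by simp
  qed
  let ?e = "ext_predim (\<lambda>Z. predim R (f ` Z)) A w"
  have pS: "predim S Y = ?e Y" if "Y \<subseteq> B" for Y
  proof -
    have Y: "finite Y" using that B(1) finite_subset by blast
    have "predim S Y = ext_predim (\<lambda>Z. int (card Z) - int (triple_weight (\<lambda>T. mult R (f ` T)) Z)) A w Y"
      by (rule predim_split[OF tS Y A w0]) (use mult that in auto)
    moreover have inj: "inj_on f (Y \<inter> A)" using f(1) by (rule inj_on_subset) auto
    ultimately show ?thesis
      using predim_eq_triple_weight[OF tM, of "f ` (Y \<inter> A)"] triple_weight_image[OF inj] card_image[OF inj] Y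
      unfolding ext_predim_def by simp
  qed
  have fA0: "strong (\<lambda>Z. predim R (f ` Z)) {} A"
    using strongD(2)[OF f(2)] strongD[OF M0] unfolding strong_def by (auto simp: image_subset_iff)
  have S1: "strong (predim S) {} B"
    by (rule iffD2[OF strong_cong[OF pS] strong_empty_ext_predim[OF fA0 w B]])
  have S2: "strong (predim S) A B"
    by (rule iffD2[OF strong_cong[OF pS] strong_ext_predim[OF w B]])
  have "\<exists>g. embedding g B S M R \<and> (\<forall>a\<in>A. g a = f a) \<and> strong (predim R) (g ` B) M"
  proof (rule generic_structure_extend[OF gen B SB f SA S1 S2])
    show "ternary_structure (e ` B) (map_rel3 e S)" if "inj_on e B" for e :: "'c \<Rightarrow> nat"
      using ternary_structure_map_rel3[OF tS that] .
    show "predim (map_rel3 e S) (e ` Y) = predim S Y"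
      if e: "embedding e B S (e ` B) (map_rel3 e S)" "Y \<subseteq> B" for e :: "'c \<Rightarrow> nat" and Y
      using predim_embedding[OF e(1) ternary_structure_map_rel3[OF tS] tS e(2)]
        embeddingD(1)[OF e(1)] finite_subset[OF e(2) B(1)] by simp
  qed
  then obtain g where g: "embedding g B S M R" "\<forall>a\<in>A. g a = f a" "strong (predim R) (g ` B) M"
    by (elim exE conjE)
  have "predim R (g ` Y) = ?e Y" if "Y \<subseteq> B" for Y
    using predim_embedding[OF g(1) tM tS that finite_subset[OF that B(1)]] pS[OF that] by simp
  then show "\<exists>g. inj_on g B \<and> (\<forall>a\<in>A. g a = f a) \<and> strong (predim R) (g ` B) M \<and>
      (\<forall>Y\<subseteq>B. predim R (g ` Y) = ?e Y)"
    using g embeddingD(1)[OF g(1)] by (intro exI[of _ g]) simp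
qed

lemma submodular_predim:
  assumes "ternary_structure M R"
  shows "submodular M (predim R)"
  using submodular_triple_weight predim_eq_triple_weight[OF assms] by (rule submodular_cong)

section \<open>Transversals of finite families\<close>

text \<open>Hall's theorem, by Rado's argument: as long as some \<open>A i\<close> has two elements \<open>x\<close> and \<open>y\<close>, one
  of them can be removed without violating the condition, since witnesses against both removals would
  contradict the condition for their union and their intersection.\<close>

lemma hall_transversal:
  fixes A :: "'i \<Rightarrow> 'a set"
  assumes "finite I" "\<And>i. i \<in> I \<Longrightarrow> finite (A i)"
    and "\<And>J. J \<subseteq> I \<Longrightarrow> card J \<le> card (\<Union> (A ` J))"
  shows "\<exists>v. inj_on v I \<and> (\<forall>i\<in>I. v i \<in> A i)"
  using assms
proof (induction "\<Sum>i\<in>I. card (A i)" arbitrary: A rule: less_induct)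
  case less
  have ne: "A i \<noteq> {}" if "i \<in> I" for i
    using less.prems(3)[of "{i}"] that by auto
  show ?case
  proof (cases "\<exists>i\<in>I. \<exists>x\<in>A i. \<exists>y\<in>A i. x \<noteq> y")
    case False
    define v where "v i = (SOME x. x \<in> A i)" for i
    have v: "v i \<in> A i" if "i \<in> I" for i
      unfolding v_def using ne[OF that] by (simp add: some_in_eq)
    have single: "A i = {v i}" if "i \<in> I" for i
      using False v[OF that] that by blast
    have "inj_on v I"
    proof (rule inj_onI, rule ccontr)
      fix i j assume "i \<in> I" "j \<in> I" "v i = v j" "i \<noteq> j"
      then show False using less.prems(3)[of "{i, j}"] single[of i] single[of j] by simp
    qed
    with v show ?thesis by blast
  next
    case True
    then obtain i x y where i: "i \<in> I" "x \<in> A i" "y \<in> A i" "x \<noteq> y" by blast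
    have fin: "finite (\<Union> (A ` J))" if "J \<subseteq> I" for J
      using finite_subset[OF that less.prems(1)] less.prems(2) that by auto
    have remove: "(\<exists>v. inj_on v I \<and> (\<forall>i\<in>I. v i \<in> A i)) \<or>
        (\<exists>J. J \<subseteq> I \<and> i \<notin> J \<and> card (\<Union> (A ` J) \<union> (A i - {z})) \<le> card J)"
      if z: "z \<in> A i" for z
    proof (cases "\<forall>J. J \<subseteq> I \<longrightarrow> card J \<le> card (\<Union> ((A(i := A i - {z})) ` J))")
      case True
      let ?B = "A(i := A i - {z})"
      have "(\<Sum>j\<in>I. card (?B j)) < (\<Sum>j\<in>I. card (A j))"
      proof (rule sum_strict_mono_ex1[OF less.prems(1)])
        show "\<forall>j\<in>I. card (?B j) \<le> card (A j)"
          using less.prems(2) by (auto intro: card_mono)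
        show "\<exists>j\<in>I. card (?B j) < card (A j)"
          using i(1) card_Diff1_less[OF less.prems(2)[OF i(1)] z] by (intro bexI[of _ i]) auto
      qed
      moreover have "finite (?B j)" if "j \<in> I" for j using less.prems(2)[OF that] less.prems(2)[OF i(1)] by auto
      ultimately have "\<exists>v. inj_on v I \<and> (\<forall>j\<in>I. v j \<in> ?B j)"
        using less.hyps[of ?B] less.prems(1) True by blast
      then obtain v where v: "inj_on v I" "\<forall>j\<in>I. v j \<in> ?B j" by blast
      have "v j \<in> A j" if "j \<in> I" for j
        using v(2)[rule_format, OF that] by (auto split: if_splits)
      with v(1) show ?thesis by blast
    next
      case False
      then obtain J where J: "J \<subseteq> I" "card (\<Union> ((A(i := A i - {z})) ` J)) < card J"
        by (auto simp: not_le)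
      have iJ: "i \<in> J"
      proof (rule ccontr)
        assume "i \<notin> J"
        then have "\<Union> ((A(i := A i - {z})) ` J) = \<Union> (A ` J)" by auto
        then show False using J less.prems(3)[OF J(1)] by simp
      qed
      have "\<Union> ((A(i := A i - {z})) ` J) = \<Union> (A ` (J - {i})) \<union> (A i - {z})"
        using iJ by (auto split: if_splits)
      moreover have "card J = Suc (card (J - {i}))"
        by (rule card.remove[OF finite_subset[OF J(1) less.prems(1)] iJ])
      ultimately have "card (\<Union> (A ` (J - {i})) \<union> (A i - {z})) \<le> card (J - {i})"
        using J(2) by simp
      moreover have "J - {i} \<subseteq> I" "i \<notin> J - {i}" using J(1) by auto
      ultimately show ?thesis by (intro disjI2 exI[of _ "J - {i}"] conjI)
    qed
    show ?thesis
    proof (rule ccontr)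
      assume no: "\<not> ?thesis"
      have viol: "\<exists>J. J \<subseteq> I \<and> i \<notin> J \<and> card (\<Union> (A ` J) \<union> (A i - {z})) \<le> card J"
        if "z \<in> A i" for z
        using remove[OF that]
      proof
        assume "\<exists>v. inj_on v I \<and> (\<forall>i\<in>I. v i \<in> A i)"
        with no show ?thesis by contradiction
      qed
      obtain J where J: "J \<subseteq> I" "i \<notin> J" "card (\<Union> (A ` J) \<union> (A i - {x})) \<le> card J"
        using viol[OF i(2)] by (elim exE conjE)
      obtain K where K: "K \<subseteq> I" "i \<notin> K" "card (\<Union> (A ` K) \<union> (A i - {y})) \<le> card K"
        using viol[OF i(3)] by (elim exE conjE)
      \<comment> \<open>The union of \<open>?U\<close> and \<open>?V\<close> contains \<open>A i\<close>, because \<open>x \<noteq> y\<close>.\<close>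
      let ?U = "\<Union> (A ` J) \<union> (A i - {x})" and ?V = "\<Union> (A ` K) \<union> (A i - {y})"
      have finU: "finite ?U" "finite ?V" using fin J(1) K(1) less.prems(2)[OF i(1)] by auto
      have finJ: "finite J" "finite K" using finite_subset[OF J(1)] finite_subset[OF K(1)] less.prems(1) by auto
      have "?U \<union> ?V = \<Union> (A ` insert i (J \<union> K))" using i(4) by auto
      then have "card (insert i (J \<union> K)) \<le> card (?U \<union> ?V)"
        using less.prems(3)[of "insert i (J \<union> K)"] i(1) J(1) K(1) by simp
      then have "card (J \<union> K) + 1 \<le> card (?U \<union> ?V)" using J(2) K(2) finJ by simp
      moreover have "card (J \<inter> K) \<le> card (?U \<inter> ?V)"
      proof -
        have "card (J \<inter> K) \<le> card (\<Union> (A ` (J \<inter> K)))" using less.prems(3)[of "J \<inter> K"] J(1) by auto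
        also have "\<dots> \<le> card (?U \<inter> ?V)" using finU by (intro card_mono) auto
        finally show ?thesis .
      qed
      ultimately show False
        using J(3) K(3) card_Un_Int[OF finJ] card_Un_Int[OF finU] by linarith
    qed
  qed
qed

section \<open>Symmetric relations as three-uniform hypergraphs and the clique predimension\<close>

definition hypergraph :: "'a set \<Rightarrow> 'a set set \<Rightarrow> bool" where
  "hypergraph M E \<longleftrightarrow> (\<forall>T\<in>E. T \<subseteq> M \<and> card T = 3)"

definition edges :: "'a rel3 \<Rightarrow> 'a set set" where
  "edges R = {{x, y, z} | x y z. (x, y, z) \<in> R}"

definition hpredim :: "'a set set \<Rightarrow> 'a set \<Rightarrow> int" where
  "hpredim E Y = int (card Y) - int (triple_weight (\<lambda>T. if T \<in> E then 1 else 0) Y)"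

definition link :: "'a set set \<Rightarrow> 'a set \<Rightarrow> 'a set" where
  "link E p = {c. c \<notin> p \<and> insert c p \<in> E}"

definition pairs :: "'a set \<Rightarrow> 'a set set" where
  "pairs M = {p. p \<subseteq> M \<and> card p = 2}"

text \<open>The subtraction \<open>- 2\<close> is that of natural numbers, so pairs with at most two points of \<open>Y\<close> in
  their link contribute nothing.  Only pairs inside \<open>F\<close> are counted: for a strong set \<open>F\<close> containing
  \<open>Y\<close> no other pair contributes.\<close>

definition clique_predim :: "'a set set \<Rightarrow> 'a set \<Rightarrow> 'a set \<Rightarrow> int" where
  "clique_predim E F Y = int (card Y) - (\<Sum>p\<in>pairs F. int (card (link E p \<inter> Y) - 2))"

lemma finite_pairs: "finite F \<Longrightarrow> finite (pairs F)"
  unfolding pairs_def by (rule finite_subset[of _ "Pow F"]) auto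

lemma triple_weight_indicator:
  assumes "finite Y"
  shows "triple_weight (\<lambda>T. if T \<in> E then 1 else 0) Y = card {T \<in> E. T \<subseteq> Y \<and> card T = 3}"
proof -
  have "triple_weight (\<lambda>T. if T \<in> E then 1 else 0) Y = card {T \<in> {T. T \<subseteq> Y \<and> card T = 3}. T \<in> E}"
    unfolding triple_weight_def using finite_triples[OF assms] by (simp add: sum.inter_filter[symmetric])
  also have "{T \<in> {T. T \<subseteq> Y \<and> card T = 3}. T \<in> E} = {T \<in> E. T \<subseteq> Y \<and> card T = 3}" by auto
  finally show ?thesis .
qed

lemma hpredim_eq:
  assumes "hypergraph M E" "finite Y"
  shows "hpredim E Y = int (card Y) - int (card {T \<in> E. T \<subseteq> Y})"
proof -
  have "{T \<in> E. T \<subseteq> Y \<and> card T = 3} = {T \<in> E. T \<subseteq> Y}"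
    using assms(1) unfolding hypergraph_def by auto
  then show ?thesis unfolding hpredim_def using triple_weight_indicator[OF assms(2), of E] by simp
qed

lemma submodular_hpredim: "submodular N (hpredim E)"
  unfolding hpredim_def[abs_def] by (rule submodular_triple_weight)

lemma predim_sym_eq: "finite Y \<Longrightarrow> predim_sym R Y = hpredim (edges R) Y"
proof -
  assume Y: "finite Y"
  have "{T. T \<subseteq> Y \<and> card T = 3 \<and> (\<exists>x y z. T = {x, y, z} \<and> (x, y, z) \<in> R)}
      = {T \<in> edges R. T \<subseteq> Y \<and> card T = 3}"
    unfolding edges_def by blast
  then show ?thesis unfolding predim_sym_def hpredim_def using triple_weight_indicator[OF Y, of "edges R"] by simp
qed

lemma strong_predim_sym: "strong (predim_sym R) A N \<longleftrightarrow> strong (hpredim (edges R)) A N"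
  unfolding strong_def using predim_sym_eq by (metis (no_types, lifting))

lemma hypergraph_edges: "sym_ternary_structure M R \<Longrightarrow> hypergraph M (edges R)"
  unfolding sym_ternary_structure_def ternary_structure_def hypergraph_def edges_def by fastforce

lemma sym_ternary_perm:
  assumes "sym_ternary_structure M R" "(u, v, w) \<in> R" "{u, v, w} = {x, y, z}"
  shows "(x, y, z) \<in> R"
proof -
  have 1: "(b, a, c) \<in> R" and 2: "(a, c, b) \<in> R" if "(a, b, c) \<in> R" for a b c
    using assms(1) that unfolding sym_ternary_structure_def by auto
  have perms: "(u, w, v) \<in> R" "(v, u, w) \<in> R" "(v, w, u) \<in> R" "(w, u, v) \<in> R" "(w, v, u) \<in> R"
    using assms(2) 1 2 by metis+
  have "u \<noteq> v" "u \<noteq> w" "v \<noteq> w"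
    using assms(1,2) unfolding sym_ternary_structure_def ternary_structure_def by auto
  then have "card {x, y, z} = 3" unfolding assms(3)[symmetric] by simp
  then have "x \<noteq> y" "x \<noteq> z" "y \<noteq> z"
    by (auto simp: card_insert_if split: if_splits)
  moreover have "x \<in> {u, v, w}" "y \<in> {u, v, w}" "z \<in> {u, v, w}"
    unfolding assms(3) by simp_all
  ultimately show ?thesis using assms(2) perms by auto
qed

lemma clique_of_eq_link:
  assumes "sym_ternary_structure M R" "x \<noteq> y"
  shows "clique_of R x y = link (edges R) {x, y}"
proof (intro subset_antisym subsetI)
  fix c assume "c \<in> clique_of R x y"
  then have c: "(c, x, y) \<in> R" unfolding clique_of_def by simp
  then have "c \<noteq> x" "c \<noteq> y"
    using assms(1) unfolding sym_ternary_structure_def ternary_structure_def by auto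
  then show "c \<in> link (edges R) {x, y}" using c unfolding link_def edges_def by auto
next
  fix c assume "c \<in> link (edges R) {x, y}"
  then obtain u v w where "(u, v, w) \<in> R" "{u, v, w} = {c, x, y}"
    unfolding link_def edges_def by auto
  then show "c \<in> clique_of R x y"
    using sym_ternary_perm[OF assms(1)] unfolding clique_of_def by auto
qed

text \<open>Adding \<open>p\<close> to \<open>F\<close> adds at most two points, hence at most two relations.\<close>

lemma card_link_le_2:
  assumes "hypergraph M E" "strong (hpredim E) F M" "p \<in> pairs M" "\<not> p \<subseteq> F"
  shows "card (link E p \<inter> F) \<le> 2"
proof -
  note F = strongD[OF assms(2)]
  have p: "finite p" "card p = 2" "p \<subseteq> M" using assms(3) unfolding pairs_def
    by (auto intro: card_ge_0_finite)
  have fin: "finite {T \<in> E. T \<subseteq> F \<union> p}" using F(1) p by auto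
  let ?N = "(\<lambda>c. insert c p) ` (link E p \<inter> F)"
  have "card ?N = card (link E p \<inter> F)"
    by (rule card_image) (auto simp: inj_on_def link_def)
  moreover have "{T \<in> E. T \<subseteq> F} \<inter> ?N = {}" using assms(4) by auto
  moreover have "finite {T \<in> E. T \<subseteq> F}" "finite ?N" using F(1) by auto
  ultimately have "card {T \<in> E. T \<subseteq> F} + card (link E p \<inter> F) = card ({T \<in> E. T \<subseteq> F} \<union> ?N)"
    by (simp add: card_Un_disjoint)
  also have "\<dots> \<le> card {T \<in> E. T \<subseteq> F \<union> p}"
    using fin by (intro card_mono) (auto simp: link_def)
  finally have "card {T \<in> E. T \<subseteq> F} + card (link E p \<inter> F) \<le> card {T \<in> E. T \<subseteq> F \<union> p}" .
  moreover have "hpredim E F \<le> hpredim E (F \<union> p)" using F p by auto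
  moreover have "card (F \<union> p) \<le> card F + 2" using card_Un_le[of F p] p by simp
  ultimately show ?thesis using hpredim_eq[OF assms(1), of F] hpredim_eq[OF assms(1), of "F \<union> p"] F(1) p(1)
    by simp
qed

text \<open>The definition groups pairs by their clique, and cliques by their trace on \<open>Y\<close>.  Undoing both
  groupings leaves a sum over pairs.  All sets counted are finite since only pairs inside the finite
  set \<open>F\<close> have three points of \<open>Y\<close> in their clique.\<close>

lemma predim_s_eq:
  assumes sym: "sym_ternary_structure M R" and F: "strong (hpredim (edges R)) F M" and "Y \<subseteq> F"
  shows "predim_s M R Y = clique_predim (edges R) F Y"
proof -
  let ?L = "link (edges R)"
  let ?P = "{p \<in> pairs M. 3 \<le> card (?L p \<inter> Y)}"
  note h = hypergraph_edges[OF sym]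
  have finF: "finite F" "F \<subseteq> M" using strongD[OF F] by auto
  have finY: "finite Y" using assms(3) finF finite_subset by auto
  have PF: "?P \<subseteq> pairs F"
  proof
    fix p assume p: "p \<in> ?P"
    have "card (?L p \<inter> Y) \<le> card (?L p \<inter> F)"
      using assms(3) finF by (intro card_mono) auto
    then have "p \<subseteq> F" using card_link_le_2[OF h F, of p] p by fastforce
    then show "p \<in> pairs F" using p unfolding pairs_def by auto
  qed
  have finP: "finite ?P" using PF finite_pairs[OF finF(1)] finite_subset by blast
  have big: "infinite (?L p) \<or> 3 \<le> card (?L p)" if "3 \<le> card (?L p \<inter> Y)" for p
    using that card_mono[of "?L p" "?L p \<inter> Y"] by fastforce
  have pairE: "\<exists>x y. x \<in> M \<and> y \<in> M \<and> x \<noteq> y \<and> p = {x, y} \<and> clique_of R x y = ?L p" if pM: "p \<in> pairs M" for p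
  proof -
    obtain x y where "p = {x, y}" "x \<noteq> y" using pM unfolding pairs_def card_2_iff by auto
    then show ?thesis using pM clique_of_eq_link[OF sym] unfolding pairs_def
      by (intro exI[of _ x] exI[of _ y]) simp
  qed
  have pairI: "{x, y} \<in> pairs M" if "x \<in> M" "y \<in> M" "x \<noteq> y" for x y
    using that unfolding pairs_def by auto
  have K: "cliques M R = ?L ` {p \<in> pairs M. infinite (?L p) \<or> 3 \<le> card (?L p)}" (is "_ = ?K")
  proof (intro subset_antisym subsetI)
    fix C assume "C \<in> cliques M R"
    then obtain x y where xy: "C = clique_of R x y" "x \<in> M" "y \<in> M" "x \<noteq> y" "infinite C \<or> 3 \<le> card C"
      unfolding cliques_def by auto
    then show "C \<in> ?K" using pairI[of x y] clique_of_eq_link[OF sym xy(4)] by auto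
  next
    fix C assume "C \<in> ?K"
    then obtain p where p: "p \<in> pairs M" "C = ?L p" "infinite C \<or> 3 \<le> card C" by auto
    obtain x y where "x \<in> M" "y \<in> M" "x \<noteq> y" "clique_of R x y = C"
      using pairE[OF p(1)] p(2) by auto
    with p(3) show "C \<in> cliques M R" unfolding cliques_def by blast
  qed
  have m: "premult M R C = card {p \<in> pairs M. ?L p = C}" for C
  proof -
    have "{{x, y} | x y. x \<in> M \<and> y \<in> M \<and> x \<noteq> y \<and> C = clique_of R x y} = {p \<in> pairs M. ?L p = C}"
    proof (intro subset_antisym subsetI)
      fix p assume "p \<in> {{x, y} | x y. x \<in> M \<and> y \<in> M \<and> x \<noteq> y \<and> C = clique_of R x y}"
      then obtain x y where xy: "p = {x, y}" "x \<in> M" "y \<in> M" "x \<noteq> y" "C = clique_of R x y" by auto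
      then show "p \<in> {p \<in> pairs M. ?L p = C}" using pairI[of x y] clique_of_eq_link[OF sym xy(4)] by auto
    next
      fix p assume "p \<in> {p \<in> pairs M. ?L p = C}"
      then show "p \<in> {{x, y} | x y. x \<in> M \<and> y \<in> M \<and> x \<noteq> y \<and> C = clique_of R x y}"
        using pairE[of p] by blast
    qed
    then show ?thesis unfolding premult_def by simp
  qed
  have ic: "induced_cliques (cliques M R) Y = (\<lambda>p. ?L p \<inter> Y) ` ?P"
    unfolding induced_cliques_def K using big by auto
  have im: "induced_mult (cliques M R) (premult M R) Y D = card {p \<in> ?P. ?L p \<inter> Y = D}"
    if D: "3 \<le> card D" for D
  proof -
    let ?Q = "{p \<in> ?P. ?L p \<inter> Y = D}"
    have finQ: "finite ?Q" by (rule finite_subset[OF _ finP]) auto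
    have CK: "{C \<in> cliques M R. C \<inter> Y = D} = ?L ` ?Q"
      unfolding K using big D by auto
    have "card {p \<in> pairs M. ?L p = C} = (\<Sum>p\<in>{p \<in> ?Q. ?L p = C}. 1)" if "C \<in> ?L ` ?Q" for C
    proof -
      have "{p \<in> pairs M. ?L p = C} = {p \<in> ?Q. ?L p = C}" using that by auto
      then show ?thesis by simp
    qed
    then have "induced_mult (cliques M R) (premult M R) Y D
       = (\<Sum>C\<in>?L ` ?Q. \<Sum>p\<in>{p \<in> ?Q. ?L p = C}. 1)"
      unfolding induced_mult_def CK m by (intro sum.cong) auto
    also have "\<dots> = (\<Sum>p\<in>?Q. 1)" by (rule sum.image_gen[OF finQ, symmetric])
    finally show ?thesis by simp
  qed
  have "(\<Sum>D\<in>induced_cliques (cliques M R) Y.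
          int (induced_mult (cliques M R) (premult M R) Y D) * (int (card D) - 2))
      = (\<Sum>D\<in>(\<lambda>p. ?L p \<inter> Y) ` ?P. \<Sum>p\<in>{p \<in> ?P. ?L p \<inter> Y = D}. int (card (?L p \<inter> Y)) - 2)"
    unfolding ic by (intro sum.cong refl) (auto simp: im)
  also have "\<dots> = (\<Sum>p\<in>?P. int (card (?L p \<inter> Y)) - 2)"
    by (rule sum.image_gen[OF finP, symmetric])
  also have "\<dots> = (\<Sum>p\<in>?P. int (card (?L p \<inter> Y) - 2))"
    by (intro sum.cong) auto
  also have "\<dots> = (\<Sum>p\<in>pairs F. int (card (?L p \<inter> Y) - 2))"
    using PF finite_pairs[OF finF(1)] finF(2)
    by (intro sum.mono_neutral_left) (auto simp: pairs_def)
  finally show ?thesis unfolding predim_s_def predim_cliques_def clique_predim_def by simp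
qed

section \<open>Strong sets of the hypergraph are strong for the clique predimension\<close>

lemma inj_on_insert_pair: "inj_on (\<lambda>c. insert c p) (- p)"
  by (rule inj_onI) blast

text \<open>Strength of \<open>F\<close> says that any set of relations outside \<open>F\<close> has at least as many points outside
  \<open>F\<close> as it has members, which is Hall's condition.\<close>

lemma hall_orientation:
  assumes E: "hypergraph M E" and F: "strong (hpredim E) F M"
    and W: "finite W" "F \<subseteq> W" "W \<subseteq> M"
  obtains v where "inj_on v {T \<in> E. T \<subseteq> W \<and> \<not> T \<subseteq> F}"
    "\<And>T. T \<in> E \<Longrightarrow> T \<subseteq> W \<Longrightarrow> \<not> T \<subseteq> F \<Longrightarrow> v T \<in> T - F"
proof -
  let ?T = "{T \<in> E. T \<subseteq> W \<and> \<not> T \<subseteq> F}"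
  have finF: "finite F" using strongD[OF F] by simp
  have "\<exists>v. inj_on v ?T \<and> (\<forall>T\<in>?T. v T \<in> T - F)"
  proof (rule hall_transversal)
    show "finite ?T" using W(1) by (intro finite_subset[of ?T "Pow W"]) auto
    show "finite (T - F)" if "T \<in> ?T" for T using that W(1) by (auto intro: finite_subset)
    fix J assume J: "J \<subseteq> ?T"
    let ?U = "\<Union>T\<in>J. T - F"
    have UW: "?U \<subseteq> W" using J by blast
    have U: "finite ?U" using finite_subset[OF UW W(1)] .
    have fin: "finite {T \<in> E. T \<subseteq> F \<union> ?U}" "finite {T \<in> E. T \<subseteq> F}" "finite J"
    proof -
      have "finite (Pow (F \<union> ?U))" using finF U by simp
      then show "finite {T \<in> E. T \<subseteq> F \<union> ?U}" by (rule rev_finite_subset) blast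
      have "finite (Pow F)" using finF by simp
      then show "finite {T \<in> E. T \<subseteq> F}" by (rule rev_finite_subset) blast
      have "finite (Pow W)" using W(1) by simp
      then show "finite J" by (rule rev_finite_subset) (use J in blast)
    qed
    have "{T \<in> E. T \<subseteq> F} \<union> J \<subseteq> {T \<in> E. T \<subseteq> F \<union> ?U}" "{T \<in> E. T \<subseteq> F} \<inter> J = {}"
      using J by auto
    then have "card {T \<in> E. T \<subseteq> F} + card J \<le> card {T \<in> E. T \<subseteq> F \<union> ?U}"
      using card_Un_disjoint[OF fin(2,3)] card_mono[OF fin(1), of "{T \<in> E. T \<subseteq> F} \<union> J"] by simp
    moreover have "hpredim E F \<le> hpredim E (F \<union> ?U)"
    proof (rule strongD(3)[OF F])
      show "finite (F \<union> ?U)" using finF U by blast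
      show "F \<union> ?U \<subseteq> M" using UW W(2,3) by blast
    qed blast
    moreover have "card (F \<union> ?U) = card F + card ?U"
      by (rule card_Un_disjoint[OF finF U]) auto
    ultimately show "card J \<le> card ?U"
      using hpredim_eq[OF E finF] hpredim_eq[OF E finite_UnI[OF finF U]] by linarith
  qed
  then obtain v where v: "inj_on v ?T" "\<forall>T\<in>?T. v T \<in> T - F" by (elim exE conjE)
  show ?thesis by (rule that[OF v(1)]) (use v(2) in blast)
qed

text \<open>Let \<open>v\<close> assign to each relation outside \<open>F\<close> one of its points outside \<open>F\<close>, injectively, and let
  \<open>D p\<close> be the set of those \<open>c\<close> that are assigned to the relation \<open>p \<union> {c}\<close>.  The sets \<open>D p\<close> are
  disjoint subsets of \<open>X - F\<close>, so it suffices that passing from \<open>F\<close> to \<open>X\<close> costs the pair \<open>p\<close> at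
  most \<open>|D p|\<close>.  If \<open>p \<subseteq> F\<close>, the only point of \<open>p \<union> {c}\<close> outside \<open>F\<close> is \<open>c\<close>.  Otherwise only two
  relations through \<open>p\<close> can be assigned a point of \<open>p\<close>, and the contribution of \<open>p\<close> disregards two.\<close>

lemma strong_predim_s:
  assumes sym: "sym_ternary_structure M R" and M0: "strong (hpredim (edges R)) {} M"
    and F: "strong (hpredim (edges R)) F M"
  shows "strong (predim_s M R) F M"
proof -
  let ?E = "edges R"
  let ?L = "link ?E"
  note E = hypergraph_edges[OF sym]
  have finF: "finite F" "F \<subseteq> M" using strongD[OF F] by auto
  have "predim_s M R F \<le> predim_s M R X" if X: "finite X" "F \<subseteq> X" "X \<subseteq> M" for X
  proof -
    obtain W where W: "X \<subseteq> W" "strong (hpredim ?E) W M"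
      using strong_superset[OF M0 X(1,3)] by blast
    have finW: "finite W" "W \<subseteq> M" "F \<subseteq> W" using strongD[OF W(2)] X W(1) by auto
    obtain v where v: "inj_on v {T \<in> ?E. T \<subseteq> W \<and> \<not> T \<subseteq> F}"
      "\<And>T. T \<in> ?E \<Longrightarrow> T \<subseteq> W \<Longrightarrow> \<not> T \<subseteq> F \<Longrightarrow> v T \<in> T - F"
      using hall_orientation[OF E F finW(1,3,2)] by (metis (no_types, lifting))
    define D where "D p = {c \<in> ?L p \<inter> (X - F). v (insert c p) = c}" for p
    have finD: "finite (D p)" for p using X(1) unfolding D_def by auto
    have bound: "card (?L p \<inter> X) - 2 \<le> (card (?L p \<inter> F) - 2) + card (D p)" if p: "p \<in> pairs W" for p
    proof (cases "p \<subseteq> F")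
      case True
      have "?L p \<inter> X \<subseteq> (?L p \<inter> F) \<union> D p"
      proof
        fix c assume c: "c \<in> ?L p \<inter> X"
        have "v (insert c p) = c" if "c \<notin> F"
          using v(2)[of "insert c p"] c that True p X W unfolding link_def pairs_def by auto
        then show "c \<in> (?L p \<inter> F) \<union> D p" using c unfolding D_def by auto
      qed
      then have "card (?L p \<inter> X) \<le> card ((?L p \<inter> F) \<union> D p)"
        using finF finD by (intro card_mono) auto
      also have "\<dots> \<le> card (?L p \<inter> F) + card (D p)" by (rule card_Un_le)
      finally show ?thesis by simp
    next
      case False
      have fp: "finite p" "card p = 2" "p \<subseteq> W" using p unfolding pairs_def
        by (auto intro: card_ge_0_finite)
      let ?Q = "{c \<in> ?L p \<inter> X. v (insert c p) \<in> p}"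
      have T: "insert c p \<in> {T \<in> ?E. T \<subseteq> W \<and> \<not> T \<subseteq> F}" if "c \<in> ?L p \<inter> X" for c
        using that fp(3) W(1) False unfolding link_def by auto
      have "card ?Q \<le> card p"
      proof (rule card_inj_on_le[OF _ _ fp(1)])
        show "inj_on (\<lambda>c. v (insert c p)) ?Q"
        proof (rule inj_onI)
          fix c d assume cd: "c \<in> ?Q" "d \<in> ?Q" "v (insert c p) = v (insert d p)"
          then have "insert c p = insert d p" using inj_onD[OF v(1) cd(3)] T by blast
          then show "c = d" using cd(1,2) unfolding link_def by auto
        qed
      qed auto
      moreover have "?L p \<inter> X \<subseteq> D p \<union> ?Q"
      proof
        fix c assume c: "c \<in> ?L p \<inter> X"
        then have "v (insert c p) \<in> insert c p - F" using v(2)[of "insert c p"] T[OF c] by auto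
        then show "c \<in> D p \<union> ?Q" using c unfolding D_def by auto
      qed
      then have "card (?L p \<inter> X) \<le> card (D p \<union> ?Q)"
        using X(1) finD by (intro card_mono) auto
      moreover have "card (D p \<union> ?Q) \<le> card (D p) + card ?Q" by (rule card_Un_le)
      ultimately show ?thesis using fp(2) by linarith
    qed
    have "(\<Sum>p\<in>pairs W. card (D p)) = card (\<Union>p\<in>pairs W. D p)"
    proof (rule card_UN_disjoint[symmetric])
      show "finite (pairs W)" using finite_pairs[OF finW(1)] .
      show "\<forall>p\<in>pairs W. finite (D p)" using finD by simp
      have eq: "p = q" if pq: "p \<in> pairs W" "q \<in> pairs W" "c \<in> D p" "c \<in> D q" for p q c
      proof -
        have mem: "insert c r \<in> {T \<in> ?E. T \<subseteq> W \<and> \<not> T \<subseteq> F}" if "r \<in> pairs W" "c \<in> D r" for r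
          using that X(2) W(1) unfolding D_def link_def pairs_def by auto
        have "v (insert c p) = v (insert c q)" using pq unfolding D_def by auto
        then have "insert c p = insert c q"
          by (rule inj_onD[OF v(1) _ mem[OF pq(1,3)] mem[OF pq(2,4)]])
        then show ?thesis using pq(3,4) unfolding D_def link_def by auto
      qed
      then show "\<forall>p\<in>pairs W. \<forall>q\<in>pairs W. p \<noteq> q \<longrightarrow> D p \<inter> D q = {}"
        by (intro ballI impI equals0I) (metis IntE eq)
    qed
    also have "\<dots> \<le> card (X - F)" using X(1) by (intro card_mono) (auto simp: D_def)
    finally have sumD: "(\<Sum>p\<in>pairs W. card (D p)) \<le> card (X - F)" .
    have "(\<Sum>p\<in>pairs W. card (?L p \<inter> X) - 2)
        \<le> (\<Sum>p\<in>pairs W. (card (?L p \<inter> F) - 2) + card (D p))"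
      by (rule sum_mono[OF bound])
    also have "\<dots> \<le> (\<Sum>p\<in>pairs W. card (?L p \<inter> F) - 2) + card (X - F)"
      using sumD by (simp add: sum.distrib)
    finally have "(\<Sum>p\<in>pairs W. card (?L p \<inter> X) - 2) \<le> (\<Sum>p\<in>pairs W. card (?L p \<inter> F) - 2) + card (X - F)" .
    moreover have "card X = card F + card (X - F)"
      using X by (metis card_Diff_subset card_mono finF(1) le_add_diff_inverse)
    ultimately show ?thesis
      using predim_s_eq[OF sym W(2) finW(3)] predim_s_eq[OF sym W(2) W(1)]
      unfolding clique_predim_def by (simp flip: of_nat_sum)
  qed
  then show ?thesis using finF unfolding strong_def by auto
qed

text \<open>Each summand is a convex function of the monotone modular function \<open>|C \<inter> Y|\<close>, hence
  supermodular.\<close>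

lemma submodular_predim_s:
  assumes sym: "sym_ternary_structure M R" and M0: "strong (hpredim (edges R)) {} M"
  shows "submodular M (predim_s M R)"
  unfolding submodular_def
proof (intro allI impI, elim conjE)
  fix X Y assume XY: "finite X" "finite Y" "X \<subseteq> M" "Y \<subseteq> M"
  obtain F where F: "X \<union> Y \<subseteq> F" "strong (hpredim (edges R)) F M"
    using strong_superset[OF M0, of "X \<union> Y"] XY by auto
  let ?f = "\<lambda>p Z. card (link (edges R) p \<inter> Z) - 2"
  have "?f p X + ?f p Y \<le> ?f p (X \<union> Y) + ?f p (X \<inter> Y)" for p
  proof -
    let ?C = "link (edges R) p"
    have "card (?C \<inter> X) + card (?C \<inter> Y) = card (?C \<inter> (X \<union> Y)) + card (?C \<inter> (X \<inter> Y))"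
    proof -
      have "?C \<inter> X \<union> ?C \<inter> Y = ?C \<inter> (X \<union> Y)" "?C \<inter> X \<inter> (?C \<inter> Y) = ?C \<inter> (X \<inter> Y)" by auto
      then show ?thesis using card_Un_Int[of "?C \<inter> X" "?C \<inter> Y"] XY by simp
    qed
    moreover have "card (?C \<inter> (X \<inter> Y)) \<le> card (?C \<inter> X)" "card (?C \<inter> (X \<inter> Y)) \<le> card (?C \<inter> Y)"
      using XY by (auto intro!: card_mono)
    ultimately show ?thesis by linarith
  qed
  then have "(\<Sum>p\<in>pairs F. ?f p X + ?f p Y) \<le> (\<Sum>p\<in>pairs F. ?f p (X \<union> Y) + ?f p (X \<inter> Y))"
    by (intro sum_mono)
  then have "(\<Sum>p\<in>pairs F. ?f p X) + (\<Sum>p\<in>pairs F. ?f p Y)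
      \<le> (\<Sum>p\<in>pairs F. ?f p (X \<union> Y)) + (\<Sum>p\<in>pairs F. ?f p (X \<inter> Y))"
    by (simp only: sum.distrib)
  moreover have "X \<inter> Y \<subseteq> F" "X \<subseteq> F" "Y \<subseteq> F" using F(1) by auto
  ultimately show "predim_s M R (X \<union> Y) + predim_s M R (X \<inter> Y) \<le> predim_s M R X + predim_s M R Y"
    using predim_s_eq[OF sym F(2)] F(1) card_Un_Int[OF XY(1,2)]
    unfolding clique_predim_def by (simp flip: of_nat_sum)
qed

section \<open>Replacing cliques by triples\<close>

text \<open>Here \<open>D\<close> is the trace of a clique on \<open>B\<close> and \<open>e\<close> the pair of base points.  The triples
  \<open>e \<union> {c}\<close> replace only the part of the clique that is not already present in \<open>A\<close>.  For this the
  base points must lie in \<open>A\<close> if the clique has two points there, and otherwise contain its point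
  in \<open>A\<close>, if there is one.\<close>

lemma triple_count_in_clique:
  assumes "finite D" "e \<subseteq> D" "card e = 2" "e \<subseteq> A \<or> D \<inter> A \<subseteq> e"
  shows "(card (D \<inter> (Y \<inter> A)) - 2) + card {T. T \<subseteq> Y \<and> card T = 3 \<and> \<not> T \<subseteq> A \<and> e \<subseteq> T \<and> T \<subseteq> D}
      \<le> card (D \<inter> Y) - 2" (is "?a + card ?S \<le> ?b")
    and "e \<subseteq> Y \<Longrightarrow> card (D \<inter> Y) - 2 \<le>
      (card (D \<inter> (Y \<inter> A)) - 2) + card {T. T \<subseteq> Y \<and> card T = 3 \<and> \<not> T \<subseteq> A \<and> e \<subseteq> T \<and> T \<subseteq> D}"
proof -
  have fe: "finite e" using assms(1,2) finite_subset by blast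
  have eq: "?a + card ?S = ?b" if eY: "e \<subseteq> Y"
  proof -
    let ?N = "(D \<inter> Y) - (A \<union> e)"
    have "?S = (\<lambda>c. insert c e) ` ?N"
    proof (intro subset_antisym subsetI)
      fix T assume T: "T \<in> ?S"
      then have "card (T - e) = 1" using assms(3) fe by (simp add: card_Diff_subset)
      then obtain c where c: "T - e = {c}" by (auto simp: card_1_singleton_iff)
      then have Tc: "T = insert c e" "c \<notin> e" using T by auto
      then have "c \<notin> A" using T assms(4) by auto
      then have "c \<in> ?N" using Tc T by auto
      then show "T \<in> (\<lambda>c. insert c e) ` ?N" using Tc(1) by blast
    next
      fix T assume "T \<in> (\<lambda>c. insert c e) ` ?N"
      then obtain c where "c \<in> ?N" "T = insert c e" by blast
      then show "T \<in> ?S" using assms(2,3) fe eY by auto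
    qed
    moreover have "inj_on (\<lambda>c. insert c e) ?N"
      by (rule inj_on_subset[OF inj_on_insert_pair]) auto
    ultimately have S: "card ?S = card ?N" by (simp add: card_image)
    have split: "card (D \<inter> Y) = card (D \<inter> Y \<inter> A) + card ((D \<inter> Y) - A)"
      using card_Int_Diff assms(1) by auto
    show ?thesis
    proof (cases "e \<subseteq> A")
      case True
      then have "?N = (D \<inter> Y) - A" by auto
      moreover have "2 \<le> card (D \<inter> Y \<inter> A)"
        using card_mono[of "D \<inter> Y \<inter> A" e] assms(1-3) True eY by auto
      ultimately show ?thesis using S split by (simp add: Int_assoc)
    next
      case False
      then have DA: "D \<inter> A \<subseteq> e" using assms(4) by auto
      then have "?N = (D \<inter> Y) - e" using assms(2) by auto
      then have "card ?N = card (D \<inter> Y) - 2"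
        using card_Diff_subset[OF fe, of "D \<inter> Y"] assms(2,3) eY by auto
      moreover have "card (D \<inter> (Y \<inter> A)) \<le> 2"
        using card_mono[OF fe, of "D \<inter> (Y \<inter> A)"] DA assms(3) by auto
      ultimately show ?thesis using S by simp
    qed
  qed
  show "e \<subseteq> Y \<Longrightarrow> ?b \<le> ?a + card ?S" using eq by simp
  show "?a + card ?S \<le> ?b"
  proof (cases "e \<subseteq> Y")
    case False
    then have "?S = {}" by auto
    moreover have "card (D \<inter> (Y \<inter> A)) \<le> card (D \<inter> Y)"
      using assms(1) by (intro card_mono) auto
    ultimately show ?thesis by (simp only: card.empty)
  qed (use eq in simp)
qed

text \<open>Once a set meets a clique in three points, adding a base point of this clique costs one point and
  gains at least one.  So a maximal set \<open>Z \<supseteq> Y\<close> whose predimension does not exceed that of \<open>Y\<close> contains the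
  base points of all cliques that matter, and on \<open>Z\<close> triples and cliques count the same.\<close>

lemma triple_resolvable_predim_s:
  assumes sym: "sym_ternary_structure M R" and M0: "strong (hpredim (edges R)) {} M"
  shows "triple_resolvable M (predim_s M R)"
  unfolding triple_resolvable_def
proof (intro allI impI)
  fix A B assume AB: "strong (predim_s M R) A M \<and> strong (predim_s M R) B M \<and> A \<subseteq> B"
  then have fin: "finite A" "finite B" "B \<subseteq> M" "A \<subseteq> B" by (auto simp: strong_def)
  \<comment> \<open>Only pairs inside \<open>W\<close> can have three points of \<open>B\<close> in their clique, so \<open>P\<close> is finite.\<close>
  obtain W where W: "B \<subseteq> W" "strong (hpredim (edges R)) W M"
    using strong_superset[OF M0 fin(2,3)] by blast
  define P where "P = pairs W"
  have finP: "finite P" unfolding P_def using strongD[OF W(2)] finite_pairs by blast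
  define D where "D p = link (edges R) p \<inter> B" for p
  have finD: "finite (D p)" for p unfolding D_def using fin by simp
  have sig: "predim_s M R Y = int (card Y) - int (\<Sum>p\<in>P. card (D p \<inter> Y) - 2)" if Y: "Y \<subseteq> B" for Y
  proof -
    have "link (edges R) p \<inter> Y = D p \<inter> Y" for p unfolding D_def using Y by auto
    then show ?thesis
      using predim_s_eq[OF sym W(2), of Y] Y W(1) unfolding clique_predim_def P_def by simp
  qed
  have "\<exists>e. 3 \<le> card (D p) \<longrightarrow> e \<subseteq> D p \<and> card e = 2 \<and> (e \<subseteq> A \<or> D p \<inter> A \<subseteq> e)" for p
  proof (cases "2 \<le> card (D p \<inter> A)")
    case True
    then obtain e where "e \<subseteq> D p \<inter> A" "card e = 2" by (metis obtain_subset_with_card_n)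
    then show ?thesis by auto
  next
    case False
    then have "\<exists>e. 3 \<le> card (D p) \<longrightarrow> D p \<inter> A \<subseteq> e \<and> e \<subseteq> D p \<and> card e = 2"
      using exists_subset_between[of "D p \<inter> A" 2 "D p"] finD by auto
    then show ?thesis by blast
  qed
  then obtain e where e: "\<And>p. 3 \<le> card (D p) \<Longrightarrow> e p \<subseteq> D p \<and> card (e p) = 2 \<and> (e p \<subseteq> A \<or> D p \<inter> A \<subseteq> e p)"
    by metis
  define w where "w T = (if T \<subseteq> A then 0 else card {p \<in> P. 3 \<le> card (D p) \<and> e p \<subseteq> T \<and> T \<subseteq> D p})" for T
  define g where "g p Y = (if 3 \<le> card (D p)
     then card {T. T \<subseteq> Y \<and> card T = 3 \<and> \<not> T \<subseteq> A \<and> e p \<subseteq> T \<and> T \<subseteq> D p} else 0)" for p Y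
  have w0: "triple_weight w A = 0" unfolding triple_weight_def by (rule sum.neutral) (auto simp: w_def)
  have triple_weight: "triple_weight w Y = (\<Sum>p\<in>P. g p Y)" if Y: "Y \<subseteq> B" for Y
  proof -
    let ?t = "{T. T \<subseteq> Y \<and> card T = 3}"
    let ?c = "\<lambda>T p. \<not> T \<subseteq> A \<and> 3 \<le> card (D p) \<and> e p \<subseteq> T \<and> T \<subseteq> D p"
    have fint: "finite ?t" using Y fin(2) by (intro finite_triples) (rule finite_subset)
    have "w T = (\<Sum>p\<in>P. if ?c T p then 1 else 0)" for T
      unfolding w_def using finP by (simp add: sum.inter_filter[symmetric])
    then have "triple_weight w Y = (\<Sum>T\<in>?t. \<Sum>p\<in>P. if ?c T p then 1 else 0)"
      unfolding triple_weight_def by simp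
    also have "\<dots> = (\<Sum>p\<in>P. \<Sum>T\<in>?t. if ?c T p then 1 else 0)" by (rule sum.swap)
    also have "\<dots> = (\<Sum>p\<in>P. g p Y)"
    proof (rule sum.cong[OF refl])
      fix p
      have "(\<Sum>T\<in>?t. if ?c T p then 1 else 0) = card {T \<in> ?t. ?c T p}"
        using fint by (simp add: sum.inter_filter[symmetric])
      also have "{T \<in> ?t. ?c T p} = (if 3 \<le> card (D p)
          then {T. T \<subseteq> Y \<and> card T = 3 \<and> \<not> T \<subseteq> A \<and> e p \<subseteq> T \<and> T \<subseteq> D p} else {})" by auto
      finally show "(\<Sum>T\<in>?t. if ?c T p then 1 else 0) = g p Y" unfolding g_def by simp
    qed
    finally show ?thesis .
  qed
  have small: "card (D p \<inter> Y) - 2 = 0" if "\<not> 3 \<le> card (D p)" for p Y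
    using card_mono[OF finD, of "D p \<inter> Y" p] that by auto
  have g1: "(card (D p \<inter> (Y \<inter> A)) - 2) + g p Y \<le> card (D p \<inter> Y) - 2" for p Y
    unfolding g_def using triple_count_in_clique(1)[OF finD, of "e p" p A Y] e[of p] small by auto
  have g2: "card (D p \<inter> Y) - 2 \<le> (card (D p \<inter> (Y \<inter> A)) - 2) + g p Y"
    if "3 \<le> card (D p \<inter> Y) \<Longrightarrow> e p \<subseteq> Y" for p Y
  proof (cases "3 \<le> card (D p \<inter> Y)")
    case True
    then have "3 \<le> card (D p)" using card_mono[OF finD, of "D p \<inter> Y" p] by auto
    then show ?thesis
      unfolding g_def using triple_count_in_clique(2)[OF finD, of "e p" p A Y] e[of p] that[OF True] by auto
  qed auto
  have extY: "ext_predim (predim_s M R) A w Y =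
      int (card Y) - int (\<Sum>p\<in>P. (card (D p \<inter> (Y \<inter> A)) - 2) + g p Y)" if Y: "Y \<subseteq> B" for Y
  proof -
    have "card Y = card (Y \<inter> A) + card (Y - A)"
      using card_Int_Diff finite_subset[OF Y fin(2)] by blast
    moreover have "Y \<inter> A \<subseteq> B" using Y by auto
    ultimately show ?thesis
      using sig[of "Y \<inter> A"] triple_weight[OF Y] unfolding ext_predim_def by (simp add: sum.distrib)
  qed
  have le: "predim_s M R Y \<le> ext_predim (predim_s M R) A w Y" if Y: "Y \<subseteq> B" for Y
  proof -
    have "(\<Sum>p\<in>P. (card (D p \<inter> (Y \<inter> A)) - 2) + g p Y) \<le> (\<Sum>p\<in>P. card (D p \<inter> Y) - 2)"
      by (rule sum_mono[OF g1])
    then show ?thesis unfolding sig[OF Y] extY[OF Y] by linarith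
  qed
  have ge: "\<exists>Y'. Y \<subseteq> Y' \<and> Y' \<subseteq> B \<and> ext_predim (predim_s M R) A w Y' \<le> predim_s M R Y" if Y: "Y \<subseteq> B" for Y
  proof -
    let ?Q = "\<lambda>Z. Y \<subseteq> Z \<and> Z \<subseteq> B \<and> predim_s M R Z \<le> predim_s M R Y"
    have "\<exists>Z. ?Q Z \<and> (\<forall>X. ?Q X \<longrightarrow> card X \<le> card Z)"
    proof (rule ex_has_greatest_nat)
      show "?Q Y" using Y by simp
      show "\<forall>Z. ?Q Z \<longrightarrow> card Z < Suc (card B)" using card_mono[OF fin(2)] by (simp add: less_Suc_eq_le)
    qed
    then obtain Z where Z: "?Q Z" "\<forall>X. ?Q X \<longrightarrow> card X \<le> card Z" by (rule exE) (erule conjE)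
    have finZ: "finite Z" using Z(1) fin(2) finite_subset by blast
    \<comment> \<open>A missing base point could be added to \<open>Z\<close> without increasing the predimension.\<close>
    have closed: "e p \<subseteq> Z" if p: "p \<in> P" "3 \<le> card (D p \<inter> Z)" for p
    proof (rule subsetI, rule ccontr)
      fix c assume c: "c \<in> e p" "c \<notin> Z"
      have "3 \<le> card (D p)" using card_mono[OF finD, of "D p \<inter> Z" p] p(2) by auto
      then have cD: "c \<in> D p" using e[of p] c by auto
      then have cB: "insert c Z \<subseteq> B" using Z(1) unfolding D_def by auto
      have "D p \<inter> insert c Z = insert c (D p \<inter> Z)" using cD by auto
      then have step: "(card (D p \<inter> Z) - 2) + 1 \<le> card (D p \<inter> insert c Z) - 2"
        using c(2) p(2) finZ by simp
      have "(\<Sum>q\<in>P. (card (D q \<inter> Z) - 2) + (if q = p then 1 else 0)) \<le> (\<Sum>q\<in>P. card (D q \<inter> insert c Z) - 2)"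
      proof (rule sum_mono)
        fix q
        have "card (D q \<inter> Z) \<le> card (D q \<inter> insert c Z)" using finD by (intro card_mono) auto
        then show "(card (D q \<inter> Z) - 2) + (if q = p then 1 else 0) \<le> card (D q \<inter> insert c Z) - 2"
          using step by auto
      qed
      then have "(\<Sum>q\<in>P. card (D q \<inter> Z) - 2) + 1 \<le> (\<Sum>q\<in>P. card (D q \<inter> insert c Z) - 2)"
        using p(1) finP by (simp add: sum.distrib)
      then have "predim_s M R (insert c Z) \<le> predim_s M R Z"
      proof -
        have "Z \<subseteq> B" using Z(1) by simp
        moreover have "card (insert c Z) = card Z + 1" using c(2) finZ by simp
        ultimately show ?thesis
          using sig[OF cB] sig[of Z] \<open>_ + 1 \<le> (\<Sum>q\<in>P. card (D q \<inter> insert c Z) - 2)\<close> by linarith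
      qed
      then have "?Q (insert c Z)" using Z(1) cB by auto
      then have "card (insert c Z) \<le> card Z" using Z(2) by blast
      then show False using c(2) finZ by simp
    qed
    have ZB: "Z \<subseteq> B" using Z(1) by simp
    have "(\<Sum>p\<in>P. card (D p \<inter> Z) - 2) \<le> (\<Sum>p\<in>P. (card (D p \<inter> (Z \<inter> A)) - 2) + g p Z)"
      by (rule sum_mono[OF g2[OF closed]])
    then have "ext_predim (predim_s M R) A w Z \<le> predim_s M R Z"
      unfolding sig[OF ZB] extY[OF ZB] by linarith
    then show ?thesis using Z(1) by (intro exI[of _ Z]) auto
  qed
  show "\<exists>w. triple_weight w A = 0 \<and> (\<forall>Y\<subseteq>B. predim_s M R Y \<le> ext_predim (predim_s M R) A w Y) \<and>
      (\<forall>Y\<subseteq>B. \<exists>Y'. Y \<subseteq> Y' \<and> Y' \<subseteq> B \<and> ext_predim (predim_s M R) A w Y' \<le> predim_s M R Y)"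
    using w0 le ge by (intro exI[of _ w]) simp
qed

section \<open>Adding a private pair of points for each triple\<close>

text \<open>\<open>Old\<close> points form a strong set of the symmetric structure, \<open>New\<close> points are those of the
  extension to be realised, and \<open>Fresh j False\<close>, \<open>Fresh j True\<close> are the pair attached to the
  \<open>j\<close>-th copy of a triple.\<close>

datatype ('b, 'c) point = Old 'b | New 'c | Fresh "'c set \<times> nat" bool

text \<open>The set \<open>F\<close> contains the image of \<open>A\<close> and is strong for the symmetric relation, whereas \<open>f ` A\<close>
  is only strong for the cliques; the amalgam is therefore formed over \<open>F\<close>.\<close>

locale pair_extension =
  fixes E :: "'b set set" and F :: "'b set" and A B :: "'c set"
    and f :: "'c \<Rightarrow> 'b" and w :: "'c set \<Rightarrow> nat"
  assumes card_E: "\<And>T. T \<in> E \<Longrightarrow> card T = 3"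
    and finF: "finite F" and finB: "finite B" and AB: "A \<subseteq> B"
    and inj_f: "inj_on f A" and fA: "f ` A \<subseteq> F"
    and sparse: "sparse_over A w B"
begin

definition J :: "('c set \<times> nat) set" where
  "J = Sigma {T. T \<subseteq> B \<and> card T = 3} (\<lambda>T. {..<w T})"

definition \<phi> :: "'c \<Rightarrow> ('b, 'c) point" where
  "\<phi> x = (if x \<in> A then Old (f x) else New x)"

definition fresh_pair :: "'c set \<times> nat \<Rightarrow> ('b, 'c) point set" where
  "fresh_pair j = {Fresh j False, Fresh j True}"

definition G :: "('b, 'c) point set" where
  "G = Old ` F \<union> \<phi> ` B \<union> (\<Union>j\<in>J. fresh_pair j)"

definition EG :: "('b, 'c) point set set" where
  "EG = (`) Old ` {T \<in> E. T \<subseteq> F} \<union> {insert (\<phi> t) (fresh_pair j) | j t. j \<in> J \<and> t \<in> fst j}"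

lemma finJ: "finite J"
  unfolding J_def using finite_triples[OF finB] by blast

lemma J_D: "j \<in> J \<Longrightarrow> fst j \<subseteq> B" "j \<in> J \<Longrightarrow> card (fst j) = 3"
  unfolding J_def by auto

lemma card_J:
  assumes "Z \<subseteq> B"
  shows "card {j \<in> J. fst j \<subseteq> Z} = triple_weight w Z"
proof -
  have "{j \<in> J. fst j \<subseteq> Z} = Sigma {T. T \<subseteq> Z \<and> card T = 3} (\<lambda>T. {..<w T})"
    unfolding J_def using assms by auto
  then show ?thesis
    unfolding triple_weight_def using finite_triples[OF finite_subset[OF assms finB]] by simp
qed

lemma inj_\<phi>: "inj_on \<phi> B"
  using inj_f unfolding \<phi>_def inj_on_def by auto

lemma \<phi>_not_Fresh: "\<phi> x \<noteq> Fresh j b \<and> Fresh j b \<noteq> \<phi> x" unfolding \<phi>_def by auto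

lemma \<phi>_not_in_fresh_pair: "\<phi> x \<notin> fresh_pair j" unfolding fresh_pair_def using \<phi>_not_Fresh by auto

lemma card_Old: "card (Old ` q :: ('b, 'c) point set) = card q"
  by (rule card_image) (auto simp: inj_on_def)

lemma card_fresh_pair: "card (fresh_pair j) = 2" "finite (fresh_pair j)" unfolding fresh_pair_def by auto

lemma finG: "finite G" unfolding G_def using finF finB finJ card_fresh_pair(2) by auto

lemma EG_cases:
  assumes "T \<in> EG"
  obtains (old) T0 where "T0 \<in> E" "T0 \<subseteq> F" "T = Old ` T0"
    | (new) j t where "j \<in> J" "t \<in> fst j" "T = insert (\<phi> t) (fresh_pair j)"
  using assms unfolding EG_def by blast

lemma hypergraph_EG: "hypergraph G EG"
  unfolding hypergraph_def
proof (intro ballI)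
  fix T assume "T \<in> EG"
  then show "T \<subseteq> G \<and> card T = 3"
  proof (cases rule: EG_cases)
    case (old T0)
    then show ?thesis using card_E[of T0] card_image[of Old T0] unfolding G_def by (auto simp: inj_on_def)
  next
    case (new j t)
    then have "t \<in> B" using J_D(1)[OF new(1)] by blast
    then have "T \<subseteq> G" using new unfolding G_def by blast
    then show ?thesis using new card_fresh_pair \<phi>_not_in_fresh_pair[of t j] by simp
  qed
qed

lemma Old_image_in_EG:
  assumes "T \<subseteq> F"
  shows "Old ` T \<in> EG \<longleftrightarrow> T \<in> E"
proof
  assume "Old ` T \<in> EG"
  then show "T \<in> E"
  proof (cases rule: EG_cases)
    case (old T0)
    then show ?thesis by (metis inj_image_eq_iff injI point.inject(1))
  next
    case (new j t)
    then have "Fresh j False \<in> Old ` T" unfolding fresh_pair_def by auto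
    then show ?thesis by auto
  qed
next
  assume "T \<in> E"
  then show "Old ` T \<in> EG" using assms unfolding EG_def by blast
qed

lemma hpredim_EG_Old:
  assumes "Y \<subseteq> F"
  shows "hpredim EG (Old ` Y) = hpredim E Y"
proof -
  have inj: "inj_on Old Y" by (auto simp: inj_on_def)
  have "triple_weight (\<lambda>T. if T \<in> EG then 1 else 0) (Old ` Y) = triple_weight (\<lambda>T. if T \<in> E then 1 else 0) Y"
    unfolding triple_weight_image[OF inj] using Old_image_in_EG assms by (intro triple_weight_cong) auto
  then show ?thesis unfolding hpredim_def using card_image[OF inj] by simp
qed

text \<open>The pair of index \<open>j\<close> adds two points to \<open>Y\<close> and at most three relations, and three only if the
  whole triple lies in \<open>Y\<close>.  So the loss is at most the weight of the triples in the part \<open>Z\<close> of \<open>B\<close>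
  present in \<open>Y\<close>, which the points of \<open>Z - A\<close> make up for.\<close>

lemma strong_Old: "strong (hpredim EG) (Old ` F) G"
proof -
  have "hpredim EG (Old ` F) \<le> hpredim EG Y" if Y: "Old ` F \<subseteq> Y" "Y \<subseteq> G" for Y
  proof -
    define Z where "Z = {x \<in> B. \<phi> x \<in> Y}"
    define K where "K = {j \<in> J. fresh_pair j \<subseteq> Y}"
    have ZB: "Z \<subseteq> B" unfolding Z_def by auto
    have finZ: "finite Z" using ZB finB finite_subset by blast
    have finK: "finite K" unfolding K_def using finJ by simp
    have finY: "finite Y" using Y(2) finG finite_subset by blast
    let ?O = "(`) Old ` {T \<in> E. T \<subseteq> F} :: ('b, 'c) point set set"
    let ?N = "\<Union>j\<in>K. (\<lambda>t. insert (\<phi> t) (fresh_pair j)) ` (fst j \<inter> Z)"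
    have "{T \<in> EG. T \<subseteq> Y} \<subseteq> ?O \<union> ?N"
    proof
      fix T assume T: "T \<in> {T \<in> EG. T \<subseteq> Y}"
      then have "T \<in> EG" by simp
      then show "T \<in> ?O \<union> ?N"
      proof (cases rule: EG_cases)
        case (new j t)
        then have "j \<in> K" "t \<in> Z" using T J_D(1)[OF new(1)] unfolding K_def Z_def by blast+
        then show ?thesis using new by auto
      qed auto
    qed
    moreover have finE: "finite {T \<in> E. T \<subseteq> F}"
      by (rule finite_subset[of _ "Pow F"]) (use finF in auto)
    moreover have finN: "finite ?N" using finK finZ by auto
    ultimately have "card {T \<in> EG. T \<subseteq> Y} \<le> card (?O \<union> ?N)"
      by (intro card_mono) auto
    also have "\<dots> \<le> card (?O) + card ?N" by (rule card_Un_le)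
    also have "\<dots> \<le> card {T \<in> E. T \<subseteq> F} + card ?N" using card_image_le[OF finE] by simp
    also have "card ?N \<le> 2 * card K + card (Z - A)"
    proof -
      have "card ?N \<le> (\<Sum>j\<in>K. card ((\<lambda>t. insert (\<phi> t) (fresh_pair j)) ` (fst j \<inter> Z)))"
        by (rule card_UN_le[OF finK])
      also have "\<dots> \<le> (\<Sum>j\<in>K. 2 + (if fst j \<subseteq> Z then 1 else 0))"
      proof (rule sum_mono)
        fix j assume "j \<in> K"
        then have j: "card (fst j) = 3" "finite (fst j)"
          using J_D finite_subset[OF _ finB] unfolding K_def by auto
        have "card ((\<lambda>t. insert (\<phi> t) (fresh_pair j)) ` (fst j \<inter> Z)) \<le> card (fst j \<inter> Z)"
          using finZ by (intro card_image_le) auto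
        also have "\<dots> \<le> 2 + (if fst j \<subseteq> Z then 1 else 0)"
        proof (cases "fst j \<subseteq> Z")
          case True
          then show ?thesis using card_mono[OF j(2), of "fst j \<inter> Z"] j(1) by auto
        next
          case False
          then have "card (fst j \<inter> Z) < card (fst j)" using j(2) by (intro psubset_card_mono) auto
          then show ?thesis using j(1) by simp
        qed
        finally show "card ((\<lambda>t. insert (\<phi> t) (fresh_pair j)) ` (fst j \<inter> Z)) \<le> 2 + (if fst j \<subseteq> Z then 1 else 0)" .
      qed
      also have "\<dots> = 2 * card K + card {j \<in> K. fst j \<subseteq> Z}"
      proof -
        have "(\<Sum>j\<in>K. if fst j \<subseteq> Z then 1 else 0) = card {j \<in> K. fst j \<subseteq> Z}"
          using finK by (simp add: sum.inter_filter[symmetric])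
        then show ?thesis by (simp only: sum.distrib sum_constant) simp
      qed
      also have "card {j \<in> K. fst j \<subseteq> Z} \<le> card {j \<in> J. fst j \<subseteq> Z}"
        using finJ by (intro card_mono) (auto simp: K_def)
      also have "\<dots> \<le> card (Z - A)"
        using card_J[OF ZB] sparse_over_le[OF sparse finB AB ZB] by simp
      finally show ?thesis by simp
    qed
    finally have "card {T \<in> EG. T \<subseteq> Y} \<le> card {T \<in> E. T \<subseteq> F} + (2 * card K + card (Z - A))" by simp
    moreover have "card F + (2 * card K + card (Z - A)) \<le> card Y"
    proof -
      let ?X = "\<Union>j\<in>K. fresh_pair j"
      have X: "card ?X = 2 * card K"
        using finK card_fresh_pair by (subst card_UN_disjoint) (auto simp: fresh_pair_def)
      have N: "card (New ` (Z - A) :: ('b, 'c) point set) = card (Z - A)" by (rule card_image) (auto simp: inj_on_def)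
      have oldF: "card (Old ` F :: ('b, 'c) point set) = card F" by (rule card_Old)
      have "card (Old ` F \<union> (?X \<union> New ` (Z - A))) = card F + (2 * card K + card (Z - A))"
        using X N oldF finF finZ finK card_fresh_pair(2)
        by (subst card_Un_disjoint; (subst card_Un_disjoint)?) (auto simp: fresh_pair_def)
      moreover have "Old ` F \<union> (?X \<union> New ` (Z - A)) \<subseteq> Y"
      proof -
        have "New z \<in> Y" if "z \<in> Z - A" for z
          using that unfolding Z_def \<phi>_def by auto
        then show ?thesis using Y(1) unfolding K_def by auto
      qed
      ultimately show ?thesis using card_mono[OF finY] by metis
    qed
    moreover have "hpredim EG (Old ` F) = int (card F) - int (card {T \<in> E. T \<subseteq> F})"
    proof -
      have "hypergraph UNIV E" unfolding hypergraph_def using card_E by auto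
      then show ?thesis using hpredim_EG_Old[of F] hpredim_eq[OF _ finF] by simp
    qed
    ultimately show ?thesis using hpredim_eq[OF hypergraph_EG finY] by simp
  qed
  then show ?thesis unfolding strong_def using finF unfolding G_def by auto
qed

lemma strong_empty_EG:
  assumes "strong (hpredim E) {} F"
  shows "strong (hpredim EG) {} G"
proof (rule strong_trans[OF submodular_hpredim _ strong_Old])
  have "hpredim EG {} \<le> hpredim EG Y" if Y: "Y \<subseteq> Old ` F" for Y
  proof -
    obtain Y0 where Y0: "Y0 \<subseteq> F" "Y = Old ` Y0" using Y by (auto simp: subset_image_iff)
    have "hpredim E {} \<le> hpredim E Y0"
      using strongD(3)[OF assms] Y0(1) finite_subset[OF Y0(1) finF] by auto
    then show ?thesis using hpredim_EG_Old[OF Y0(1)] hpredim_EG_Old[of "{}"] Y0(2) by simp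
  qed
  then show "strong (hpredim EG) {} (Old ` F)" unfolding strong_def by auto
qed

lemma link_EG_Old:
  assumes "q \<in> pairs F"
  shows "link EG (Old ` q) = Old ` (link E q \<inter> F)"
proof (intro subset_antisym subsetI)
  fix c assume c: "c \<in> link EG (Old ` q)"
  then have "insert c (Old ` q) \<in> EG" unfolding link_def by simp
  then show "c \<in> Old ` (link E q \<inter> F)"
  proof (cases rule: EG_cases)
    case (old T0)
    then obtain a where a: "c = Old a" "a \<in> T0" by blast
    have "(Old ` insert a q :: ('b, 'c) point set) = Old ` T0" using old(3) a by simp
    then have "insert a q = T0" by (metis inj_image_eq_iff injI point.inject(1))
    then show ?thesis using old a c unfolding link_def by auto
  next
    case (new j t)
    then have "Fresh j False \<in> insert c (Old ` q)" "Fresh j True \<in> insert c (Old ` q)"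
      unfolding fresh_pair_def by auto
    then show ?thesis by auto
  qed
next
  fix c :: "('b, 'c) point" assume "c \<in> Old ` (link E q \<inter> F)"
  then obtain a where a: "c = Old a" "a \<in> link E q" "a \<in> F" by blast
  have "insert a q \<subseteq> F" using a assms unfolding pairs_def by auto
  then have "Old ` insert a q \<in> EG" using Old_image_in_EG a(2) unfolding link_def by blast
  then show "c \<in> link EG (Old ` q)" using a unfolding link_def by auto
qed

lemma link_EG_fresh_pair:
  assumes "j \<in> J"
  shows "link EG (fresh_pair j) = \<phi> ` fst j"
proof (intro subset_antisym subsetI)
  fix c assume c: "c \<in> link EG (fresh_pair j)"
  then have "insert c (fresh_pair j) \<in> EG" unfolding link_def by simp
  then show "c \<in> \<phi> ` fst j"
  proof (cases rule: EG_cases)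
    case (old T0)
    then have "Fresh j False \<in> Old ` T0" unfolding fresh_pair_def by auto
    then show ?thesis by auto
  next
    case (new k t)
    have "\<phi> t \<in> insert c (fresh_pair j)" using new(3) by auto
    then have "\<phi> t = c" using \<phi>_not_in_fresh_pair[of t j] by blast
    moreover have "Fresh j False \<in> insert (\<phi> t) (fresh_pair k)" using new(3) unfolding fresh_pair_def by blast
    then have "k = j" using \<phi>_not_Fresh[of t j False] unfolding fresh_pair_def by auto
    ultimately show ?thesis using new(2) by auto
  qed
next
  fix c assume "c \<in> \<phi> ` fst j"
  then obtain t where t: "t \<in> fst j" "c = \<phi> t" by blast
  then have "insert c (fresh_pair j) \<in> EG" using assms unfolding EG_def by blast
  then show "c \<in> link EG (fresh_pair j)" unfolding link_def using \<phi>_not_in_fresh_pair[of t j] t(2) by simp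
qed

text \<open>Apart from old pairs and fresh pairs, a pair that lies in a relation consists of a point of the triple
  and one of its two fresh points; the other fresh point is then the only element
  of its link.\<close>

lemma link_EG_other:
  assumes "p \<in> pairs G" "p \<notin> (`) Old ` pairs F" "p \<notin> fresh_pair ` J"
  shows "card (link EG p) \<le> 1"
proof -
  have p: "finite p" "card p = 2" using assms(1) unfolding pairs_def by (auto intro: card_ge_0_finite)
  have key: "\<exists>j t b. c = Fresh j b \<and> p = {\<phi> t, Fresh j (\<not> b)}" if c: "c \<in> link EG p" for c
  proof -
    have cp: "c \<notin> p" "insert c p \<in> EG" using c unfolding link_def by auto
    from cp(2) show ?thesis
    proof (cases rule: EG_cases)
      case (old T0)
      obtain q where q: "q \<subseteq> T0" "p = Old ` q" using old(3) by (metis subset_insertI subset_image_iff)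
      have "card q = 2" using p(2) q(2) card_Old[of q] by simp
      then have "q \<in> pairs F" using q old(2) unfolding pairs_def by auto
      then show ?thesis using assms(2) q(2) by auto
    next
      case (new j t)
      have "c \<in> insert (\<phi> t) (fresh_pair j)" using new(3) by auto
      moreover have "c \<noteq> \<phi> t"
      proof
        assume "c = \<phi> t"
        then have "p = fresh_pair j" using new(3) cp(1) \<phi>_not_in_fresh_pair[of t j] by (metis insert_ident)
        then show False using assms(3) new(1) by auto
      qed
      ultimately obtain b where b: "c = Fresh j b" unfolding fresh_pair_def by auto
      have "p = insert (\<phi> t) (fresh_pair j) - {c}" using new(3) cp(1) by (metis Diff_insert_absorb)
      then have "p = {\<phi> t, Fresh j (\<not> b)}"
        using b \<phi>_not_Fresh[of t j] unfolding fresh_pair_def by (cases b) auto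
      with b show ?thesis by blast
    qed
  qed
  have "c = d" if cd: "c \<in> link EG p" "d \<in> link EG p" for c d
  proof -
    obtain j t b where 1: "c = Fresh j b" "p = {\<phi> t, Fresh j (\<not> b)}" using key[OF cd(1)] by blast
    obtain k s e where 2: "d = Fresh k e" "p = {\<phi> s, Fresh k (\<not> e)}" using key[OF cd(2)] by blast
    have "Fresh j (\<not> b) \<in> {\<phi> s, Fresh k (\<not> e)}" using 1(2) 2(2) by auto
    then show ?thesis using 1(1) 2(1) \<phi>_not_Fresh[of s j "\<not> b"] by (cases b; cases e) auto
  qed
  then have "link EG p \<subseteq> {SOME c. c \<in> link EG p}" by (metis insertI1 someI subsetI)
  then show ?thesis using card_mono[of "{SOME c. c \<in> link EG p}"] by simp
qed

text \<open>The cliques of the extension are the old ones, together with one clique of three points for every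
  fresh pair, which counts exactly when it lies inside \<open>Y\<close>.\<close>

lemma clique_predim_EG:
  assumes "Y \<subseteq> G"
  shows "clique_predim EG G Y = clique_predim E F {x \<in> F. Old x \<in> Y} + int (card (Y - Old ` F))
           - int (card {j \<in> J. \<phi> ` fst j \<subseteq> Y})"
proof -
  let ?YF = "{x \<in> F. Old x \<in> Y}"
  let ?h = "\<lambda>p. card (link EG p \<inter> Y) - 2"
  have finY: "finite Y" using assms finG finite_subset by blast
  have oldpairs: "(`) Old ` pairs F \<subseteq> pairs G"
  proof -
    show ?thesis using card_Old unfolding pairs_def G_def by auto
  qed
  have auxpairs: "fresh_pair ` J \<subseteq> pairs G"
    using card_fresh_pair(1) unfolding pairs_def G_def by auto
  have "(\<Sum>p\<in>pairs G. ?h p) = (\<Sum>p\<in>(`) Old ` pairs F \<union> fresh_pair ` J. ?h p)"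
  proof (rule sum.mono_neutral_right)
    show "finite (pairs G)" by (rule finite_pairs[OF finG])
    show "(`) Old ` pairs F \<union> fresh_pair ` J \<subseteq> pairs G" using oldpairs auxpairs by blast
    show "\<forall>p\<in>pairs G - ((`) Old ` pairs F \<union> fresh_pair ` J). ?h p = 0"
    proof
      fix p assume p: "p \<in> pairs G - ((`) Old ` pairs F \<union> fresh_pair ` J)"
      have "link EG p \<subseteq> G" using hypergraph_EG unfolding hypergraph_def link_def by auto
      then have "card (link EG p \<inter> Y) \<le> card (link EG p)"
        by (intro card_mono) (auto intro: finite_subset[OF _ finG])
      then show "?h p = 0" using link_EG_other[of p] p by simp
    qed
  qed
  also have "\<dots> = (\<Sum>p\<in>(`) Old ` pairs F. ?h p) + (\<Sum>p\<in>fresh_pair ` J. ?h p)"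
  proof (rule sum.union_disjoint)
    show "finite ((`) Old ` pairs F :: ('b, 'c) point set set)" using finite_pairs[OF finF] by simp
    show "finite (fresh_pair ` J)" using finJ by simp
    have "Old ` q \<noteq> fresh_pair j" for q j unfolding fresh_pair_def by auto
    then show "(`) Old ` pairs F \<inter> fresh_pair ` J = {}" by auto
  qed
  also have "(\<Sum>p\<in>(`) Old ` pairs F. ?h p) = (\<Sum>q\<in>pairs F. card (link E q \<inter> ?YF) - 2)"
  proof -
    have "inj_on ((`) Old :: 'b set \<Rightarrow> ('b, 'c) point set) (pairs F)"
      by (rule inj_on_subset[OF inj_on_image_Pow[of Old UNIV]]) (auto simp: inj_on_def)
    then have "(\<Sum>p\<in>(`) Old ` pairs F. ?h p) = (\<Sum>q\<in>pairs F. ?h (Old ` q))"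
      by (simp add: sum.reindex)
    also have "\<dots> = (\<Sum>q\<in>pairs F. card (link E q \<inter> ?YF) - 2)"
    proof (rule sum.cong[OF refl])
      fix q assume q: "q \<in> pairs F"
      have "link EG (Old ` q) \<inter> Y = Old ` (link E q \<inter> ?YF)"
        unfolding link_EG_Old[OF q] by auto
      then show "?h (Old ` q) = card (link E q \<inter> ?YF) - 2"
        by (simp add: card_image inj_on_def)
    qed
    finally show ?thesis .
  qed
  also have "(\<Sum>p\<in>fresh_pair ` J. ?h p) = card {j \<in> J. \<phi> ` fst j \<subseteq> Y}"
  proof -
    have "inj_on fresh_pair J" unfolding inj_on_def fresh_pair_def by auto
    then have "(\<Sum>p\<in>fresh_pair ` J. ?h p) = (\<Sum>j\<in>J. ?h (fresh_pair j))" by (simp add: sum.reindex)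
    also have "\<dots> = (\<Sum>j\<in>J. if \<phi> ` fst j \<subseteq> Y then 1 else 0)"
    proof (rule sum.cong[OF refl])
      fix j assume j: "j \<in> J"
      have "inj_on \<phi> (fst j)" using inj_\<phi> J_D(1)[OF j] inj_on_subset by blast
      then have c3: "card (\<phi> ` fst j) = 3" using J_D(2)[OF j] by (simp add: card_image)
      then have fin: "finite (\<phi> ` fst j)" by (auto intro: card_ge_0_finite)
      show "?h (fresh_pair j) = (if \<phi> ` fst j \<subseteq> Y then 1 else 0)"
      proof (cases "\<phi> ` fst j \<subseteq> Y")
        case True
        then have "\<phi> ` fst j \<inter> Y = \<phi> ` fst j" by auto
        then show ?thesis using True c3 link_EG_fresh_pair[OF j] by simp
      next
        case False
        then have "card (\<phi> ` fst j \<inter> Y) < card (\<phi> ` fst j)" using fin by (intro psubset_card_mono) auto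
        then show ?thesis using False c3 link_EG_fresh_pair[OF j] by simp
      qed
    qed
    also have "\<dots> = card {j \<in> J. \<phi> ` fst j \<subseteq> Y}"
      using finJ by (simp add: sum.inter_filter[symmetric])
    finally show ?thesis .
  qed
  finally have sum: "(\<Sum>p\<in>pairs G. ?h p)
     = (\<Sum>q\<in>pairs F. card (link E q \<inter> ?YF) - 2) + card {j \<in> J. \<phi> ` fst j \<subseteq> Y}" .
  have "card Y = card (Y \<inter> Old ` F) + card (Y - Old ` F)" using card_Int_Diff[OF finY] .
  moreover have "Y \<inter> Old ` F = Old ` ?YF" by auto
  moreover have "card (Old ` ?YF :: ('b, 'c) point set) = card ?YF" by (rule card_Old)
  ultimately have "card Y = card ?YF + card (Y - Old ` F)" by simp
  then show ?thesis
    unfolding clique_predim_def of_nat_sum[symmetric] sum by simp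
qed

lemma clique_predim_EG_image:
  assumes "Z \<subseteq> B"
  shows "clique_predim EG G (\<phi> ` Z) = ext_predim (\<lambda>Z. clique_predim E F (f ` Z)) A w Z"
proof -
  have "\<phi> ` Z \<subseteq> G" using assms unfolding G_def by auto
  moreover have "{x \<in> F. Old x \<in> \<phi> ` Z} = f ` (Z \<inter> A)"
    using fA unfolding \<phi>_def by (auto split: if_splits)
  moreover have "card (\<phi> ` Z - Old ` F) = card (Z - A)"
  proof -
    have "\<phi> ` Z - Old ` F = New ` (Z - A)"
      using fA unfolding \<phi>_def by (auto split: if_splits)
    then show ?thesis by (simp add: card_image inj_on_def)
  qed
  moreover have "{j \<in> J. \<phi> ` fst j \<subseteq> \<phi> ` Z} = {j \<in> J. fst j \<subseteq> Z}"
    using J_D(1) inj_on_image_mem_iff[OF inj_\<phi> _ assms] by (fastforce simp: image_subset_iff)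
  ultimately show ?thesis
    using clique_predim_EG[of "\<phi> ` Z"] card_J[OF assms] unfolding ext_predim_def by simp
qed

text \<open>A set containing the copy of \<open>B\<close> may have further old points, which do not lower the predimension
  because \<open>f ` A\<close> is strong in \<open>F\<close>, and fresh points, which lie in no clique with three elements.\<close>

lemma clique_predim_EG_image_le:
  assumes "\<phi> ` B \<subseteq> Y" "Y \<subseteq> G"
    and strong: "\<And>X. f ` A \<subseteq> X \<Longrightarrow> X \<subseteq> F \<Longrightarrow> clique_predim E F (f ` A) \<le> clique_predim E F X"
  shows "clique_predim EG G (\<phi> ` B) \<le> clique_predim EG G Y"
proof -
  let ?YF = "{x \<in> F. Old x \<in> Y}"
  have "f ` A \<subseteq> ?YF" using assms(1) fA AB unfolding \<phi>_def by (auto split: if_splits)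
  then have 1: "clique_predim E F (f ` A) \<le> clique_predim E F ?YF" by (rule strong) auto
  have "New ` (B - A) \<subseteq> Y - Old ` F" using assms(1) unfolding \<phi>_def by (auto split: if_splits)
  moreover have "finite (Y - Old ` F)" using assms(2) finG finite_subset by blast
  ultimately have "card (New ` (B - A) :: ('b, 'c) point set) \<le> card (Y - Old ` F)" by (rule card_mono[rotated])
  then have 2: "card (B - A) \<le> card (Y - Old ` F)" by (simp add: card_image inj_on_def)
  have "{j \<in> J. fst j \<subseteq> B} = J" using J_D(1) by blast
  then have "triple_weight w B = card J" using card_J[of B] by simp
  moreover have "card {j \<in> J. \<phi> ` fst j \<subseteq> Y} \<le> card J" using finJ by (intro card_mono) auto
  moreover have "B \<inter> A = A" using AB by auto
  ultimately show ?thesis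
    using clique_predim_EG_image[of B] clique_predim_EG[OF assms(2)] 1 2 unfolding ext_predim_def by simp
qed

end

section \<open>Realising triple extensions by cliques\<close>

definition rel_of :: "'a set set \<Rightarrow> 'a rel3" where
  "rel_of E = {(x, y, z). {x, y, z} \<in> E}"

lemma sym_ternary_structure_rel_of:
  assumes "hypergraph M E"
  shows "sym_ternary_structure M (rel_of E)"
proof -
  have 1: "x \<in> M \<and> y \<in> M \<and> z \<in> M \<and> x \<noteq> y \<and> x \<noteq> z \<and> y \<noteq> z" if "{x, y, z} \<in> E" for x y z
  proof -
    have "{x, y, z} \<subseteq> M \<and> card {x, y, z} = 3"
      by (rule bspec[OF assms[unfolded hypergraph_def] that])
    then show ?thesis using distinct_of_card_3[of x y z] by blast
  qed
  have 2: "{y, x, z} \<in> E \<and> {x, z, y} \<in> E" if "{x, y, z} \<in> E" for x y z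
    using that by (simp add: insert_commute)
  show ?thesis
    unfolding sym_ternary_structure_def ternary_structure_def rel_of_def using 1 2 by blast
qed

lemma edges_rel_of:
  assumes "hypergraph M E"
  shows "edges (rel_of E) = E"
proof -
  have "\<exists>x y z. T = {x, y, z} \<and> {x, y, z} \<in> E" if T: "T \<in> E" for T
  proof -
    have "card T = 3" using assms T unfolding hypergraph_def by simp
    then obtain x y z where "T = {x, y, z}" unfolding card_3_iff by blast
    with T show ?thesis by auto
  qed
  then show ?thesis unfolding edges_def rel_of_def by auto
qed

lemma edges_iff_mult:
  assumes "finite T"
  shows "T \<in> edges R \<longleftrightarrow> mult R T \<noteq> 0"
  unfolding edges_def mult_def
  using finite_orderings[OF assms, of "\<lambda>x y z. (x, y, z) \<in> R"] by (auto simp: card_eq_0_iff)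

lemma edges_embedding:
  assumes "embedding g B S M R" "T \<subseteq> B" "finite B"
  shows "g ` T \<in> edges R \<longleftrightarrow> T \<in> edges S"
  using finite_subset[OF assms(2,3)] mult_embedding[OF assms(1,2)] by (simp add: edges_iff_mult)

lemma predim_sym_embedding:
  assumes "embedding g B S M R" "Y \<subseteq> B" "finite B"
  shows "predim_sym R (g ` Y) = hpredim (edges S) Y"
proof -
  have fin: "finite Y" using assms(2,3) finite_subset by blast
  have inj: "inj_on g Y" using embeddingD(1)[OF assms(1)] assms(2) inj_on_subset by blast
  have "triple_weight (\<lambda>T. if T \<in> edges R then 1 else 0) (g ` Y) = triple_weight (\<lambda>T. if T \<in> edges S then 1 else 0) Y"
    unfolding triple_weight_image[OF inj] using edges_embedding[OF assms(1) _ assms(3)] assms(2)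
    by (intro triple_weight_cong) auto
  then show ?thesis
    using predim_sym_eq[of "g ` Y" R] fin card_image[OF inj] unfolding hpredim_def by simp
qed

lemma sym_ternary_structure_map_rel3:
  assumes "sym_ternary_structure B S" "inj_on e B"
  shows "sym_ternary_structure (e ` B) (map_rel3 e S)"
proof -
  have swap: "(b, a, c) \<in> map_rel3 e S \<and> (a, c, b) \<in> map_rel3 e S" if t: "(a, b, c) \<in> map_rel3 e S" for a b c
  proof -
    obtain x y z where *: "(x, y, z) \<in> S" "a = e x" "b = e y" "c = e z"
      using t unfolding map_rel3_def by auto
    then have "(y, x, z) \<in> S" "(x, z, y) \<in> S" using assms(1) unfolding sym_ternary_structure_def by auto
    then show ?thesis using * unfolding map_rel3_def by force
  qed
  have "ternary_structure B S" using assms(1) unfolding sym_ternary_structure_def by simp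
  from ternary_structure_map_rel3[OF this assms(2)] show ?thesis
    unfolding sym_ternary_structure_def by (intro conjI) (assumption, use swap in fast)
qed

lemma clique_predim_image:
  assumes inj: "inj_on g G" and E: "\<And>T. T \<subseteq> G \<Longrightarrow> g ` T \<in> E \<longleftrightarrow> T \<in> EG" and Y: "Y \<subseteq> G"
  shows "clique_predim E (g ` G) (g ` Y) = clique_predim EG G Y"
proof -
  have card: "card (g ` X) = card X" if "X \<subseteq> G" for X
    using that inj by (meson card_image inj_on_subset)
  have "pairs (g ` G) = (`) g ` pairs G"
    using card unfolding pairs_def by (auto simp: subset_image_iff image_iff)
  moreover have "inj_on ((`) g) (pairs G)"
    by (rule inj_on_subset[OF inj_on_image_Pow[OF inj]]) (auto simp: pairs_def)
  ultimately have "(\<Sum>p\<in>pairs (g ` G). int (card (link E p \<inter> g ` Y) - 2))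
      = (\<Sum>q\<in>pairs G. int (card (link E (g ` q) \<inter> g ` Y) - 2))"
    by (simp add: sum.reindex)
  also have "\<dots> = (\<Sum>q\<in>pairs G. int (card (link EG q \<inter> Y) - 2))"
  proof (rule sum.cong[OF refl])
    fix q assume "q \<in> pairs G"
    then have q: "q \<subseteq> G" unfolding pairs_def by simp
    have "g c \<in> link E (g ` q) \<longleftrightarrow> c \<in> link EG q" if c: "c \<in> G" for c
      unfolding link_def using E[of "insert c q"] c q inj_on_image_mem_iff[OF inj c q] by simp
    then have "link E (g ` q) \<inter> g ` Y = g ` (link EG q \<inter> Y)" using Y by blast
    then show "int (card (link E (g ` q) \<inter> g ` Y) - 2) = int (card (link EG q \<inter> Y) - 2)"
      using card[OF le_infI2[OF Y], of "link EG q"] by simp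
  qed
  finally show ?thesis unfolding clique_predim_def using card[OF Y] by simp
qed

text \<open>The extension by fresh pairs is embedded strongly over \<open>F\<close>.  Its image is strong for the cliques by
  \<open>strong_predim_s\<close>, and the copy of \<open>B\<close> is strong in it, so the copy of \<open>B\<close> is strong for the cliques
  in the whole structure.\<close>

lemma triple_rich_predim_s:
  assumes "sym_hrushovski_structure M R"
  shows "triple_rich TYPE('c) M (predim_s M R)"
  unfolding triple_rich_def
proof (intro allI impI)
  fix A B :: "'c set" and w f
  assume *: "finite B \<and> A \<subseteq> B \<and> inj_on f A \<and> strong (predim_s M R) (f ` A) M \<and> sparse_over A w B"
  note gen = assms[unfolded sym_hrushovski_structure_def]
  have sym: "sym_ternary_structure M R" and M0: "strong (hpredim (edges R)) {} M"
    using generic_structure_basic[OF gen] by (simp_all add: strong_predim_sym)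
  have strong_fA: "finite (f ` A)" "f ` A \<subseteq> M" "strong (predim_s M R) (f ` A) M"
    using * strongD[of "predim_s M R" "f ` A" M] by auto
  obtain F where F: "f ` A \<subseteq> F" "strong (hpredim (edges R)) F M"
    using strong_superset[OF M0 strong_fA(1,2)] by blast
  note FD = strongD[OF F(2)]
  interpret pair_extension "edges R" F A B f w
  proof
    show "card T = 3" if "T \<in> edges R" for T
      using hypergraph_edges[OF sym] that unfolding hypergraph_def by blast
  qed (use * F(1) FD(1) in auto)
  let ?S = "rel_of EG"
  note S = sym_ternary_structure_rel_of[OF hypergraph_EG]
  note hS = edges_rel_of[OF hypergraph_EG]
  let ?old = "\<lambda>p :: ('a, 'c) point. case p of Old x \<Rightarrow> x | _ \<Rightarrow> undefined"
  have old: "?old ` (Old ` F) = F" by (force simp: image_image)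
  have "\<exists>g. embedding g G ?S M R \<and> (\<forall>a\<in>Old ` F. g a = ?old a) \<and> strong (predim_sym R) (g ` G) M"
  proof (rule generic_structure_extend[OF gen finG, where \<epsilon> = "hpredim EG"])
    show "Old ` F \<subseteq> G" unfolding G_def by auto
    show "?S \<subseteq> G \<times> G \<times> G"
      using S unfolding sym_ternary_structure_def ternary_structure_def by auto
    show "inj_on ?old (Old ` F)" by (auto simp: inj_on_def)
    show "strong (predim_sym R) (?old ` (Old ` F)) M" unfolding old strong_predim_sym by (rule F(2))
    show "((x, y, z) \<in> ?S) = ((?old x, ?old y, ?old z) \<in> R)"
      if xyz: "x \<in> Old ` F" "y \<in> Old ` F" "z \<in> Old ` F" for x y z
    proof -
      obtain a b c where abc: "a \<in> F" "b \<in> F" "c \<in> F" "x = Old a" "y = Old b" "z = Old c"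
        using xyz by blast
      have "(x, y, z) \<in> ?S \<longleftrightarrow> Old ` {a, b, c} \<in> EG" unfolding rel_of_def abc by simp
      also have "\<dots> \<longleftrightarrow> {a, b, c} \<in> edges R" using abc by (intro Old_image_in_EG) simp
      also have "\<dots> \<longleftrightarrow> (a, b, c) \<in> R"
      proof
        assume "{a, b, c} \<in> edges R"
        then obtain u v w where "(u, v, w) \<in> R" "{u, v, w} = {a, b, c}" unfolding edges_def by auto
        then show "(a, b, c) \<in> R" by (rule sym_ternary_perm[OF sym])
      qed (auto simp: edges_def)
      finally show ?thesis using abc by simp
    qed
    show "strong (hpredim EG) (Old ` F) G" by (rule strong_Old)
    show "strong (hpredim EG) {} G"
      by (rule strong_empty_EG) (rule strong_subset[OF M0 _ FD(2)], simp)
    show "sym_ternary_structure (e ` G) (map_rel3 e ?S)" if "inj_on e G" for e :: "('a, 'c) point \<Rightarrow> nat"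
      using sym_ternary_structure_map_rel3[OF S that] .
    show "predim_sym (map_rel3 e ?S) (e ` Y) = hpredim EG Y"
      if "embedding e G ?S (e ` G) (map_rel3 e ?S)" "Y \<subseteq> G" for e :: "('a, 'c) point \<Rightarrow> nat" and Y
      using predim_sym_embedding[OF that finG] hS by simp
  qed
  then obtain g where g: "embedding g G ?S M R" "\<forall>a\<in>Old ` F. g a = ?old a"
    "strong (hpredim (edges R)) (g ` G) M"
    unfolding strong_predim_sym by (elim exE conjE)
  note g' = embeddingD[OF g(1)]
  have pre: "predim_s M R (g ` Y) = clique_predim EG G Y" if Y: "Y \<subseteq> G" for Y
  proof -
    have "predim_s M R (g ` Y) = clique_predim (edges R) (g ` G) (g ` Y)"
      using predim_s_eq[OF sym g(3)] Y by blast
    also have "\<dots> = clique_predim EG G Y"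
      using edges_embedding[OF g(1) _ finG] hS by (intro clique_predim_image[OF g'(1) _ Y]) simp
    finally show ?thesis .
  qed
  have phiB: "\<phi> ` B \<subseteq> G" unfolding G_def by auto
  have "strong (predim_s M R) (g ` (\<phi> ` B)) (g ` G)"
  proof -
    have "predim_s M R (g ` (\<phi> ` B)) \<le> predim_s M R X" if X: "g ` (\<phi> ` B) \<subseteq> X" "X \<subseteq> g ` G" for X
    proof -
      obtain Y where Y: "Y \<subseteq> G" "X = g ` Y" using X(2) by (auto simp: subset_image_iff)
      have "\<phi> ` B \<subseteq> Y" using X(1) Y phiB inj_on_image_mem_iff[OF g'(1)] by blast
      then have "clique_predim EG G (\<phi> ` B) \<le> clique_predim EG G Y"
      proof (rule clique_predim_EG_image_le[OF _ Y(1)])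
        fix Z assume Z: "f ` A \<subseteq> Z" "Z \<subseteq> F"
        have "predim_s M R (f ` A) \<le> predim_s M R Z"
          using strongD(3)[OF strong_fA(3), of Z] Z FD finite_subset[OF Z(2)] by auto
        then show "clique_predim (edges R) F (f ` A) \<le> clique_predim (edges R) F Z"
          using predim_s_eq[OF sym F(2)] F(1) Z(2) by simp
      qed
      then show ?thesis using pre[OF phiB] pre[OF Y(1)] Y(2) by simp
    qed
    then show ?thesis using finB phiB unfolding strong_def by auto
  qed
  then have strongB: "strong (predim_s M R) (g ` (\<phi> ` B)) M"
    using strong_trans[OF submodular_predim_s[OF sym M0] _ strong_predim_s[OF sym M0 g(3)]] by blast
  show "\<exists>g. inj_on g B \<and> (\<forall>a\<in>A. g a = f a) \<and> strong (predim_s M R) (g ` B) M \<and>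
      (\<forall>Y\<subseteq>B. predim_s M R (g ` Y) = ext_predim (\<lambda>Z. predim_s M R (f ` Z)) A w Y)"
  proof (intro exI[of _ "g \<circ> \<phi>"] conjI allI impI ballI)
    show "inj_on (g \<circ> \<phi>) B"
      using comp_inj_on[OF inj_\<phi>] inj_on_subset[OF g'(1) phiB] by blast
    show "(g \<circ> \<phi>) a = f a" if "a \<in> A" for a
      using g(2) F(1) that unfolding \<phi>_def by auto
    show "strong (predim_s M R) ((g \<circ> \<phi>) ` B) M" using strongB by (simp add: image_comp)
    fix Y assume Y: "Y \<subseteq> B"
    have "predim_s M R ((g \<circ> \<phi>) ` Y) = clique_predim EG G (\<phi> ` Y)"
      using pre[of "\<phi> ` Y"] Y phiB by (auto simp: image_comp)
    also have "\<dots> = ext_predim (\<lambda>Z. clique_predim (edges R) F (f ` Z)) A w Y" by (rule clique_predim_EG_image[OF Y])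
    also have "\<dots> = ext_predim (\<lambda>Z. predim_s M R (f ` Z)) A w Y"
    proof -
      have "f ` (Y \<inter> A) \<subseteq> F" using F(1) by auto
      then show ?thesis using predim_s_eq[OF sym F(2)] unfolding ext_predim_def by simp
    qed
    finally show "predim_s M R ((g \<circ> \<phi>) ` Y) = ext_predim (\<lambda>Z. predim_s M R (f ` Z)) A w Y" .
  qed
qed

section \<open>The isomorphism of pregeometries\<close>

theorem theorem7p12:
  fixes M :: "'a set" and R :: "'a rel3"
    and Msym :: "'b set" and Rsym :: "'b rel3"
  assumes "hrushovski_structure M R"
    and "sym_hrushovski_structure Msym Rsym"
  shows "pregeometry_isomorphic
           M (dimension (predim R) M)
           Msym (dimension (predim_s Msym Rsym) Msym)"
proof (rule pregeometry_isomorphic_triple_geometries)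
  note M = generic_structure_basic[OF assms(1)[unfolded hrushovski_structure_def]]
  note N = generic_structure_basic[OF assms(2)[unfolded sym_hrushovski_structure_def],
      unfolded strong_predim_sym]
  show "countable M" "strong (predim R) {} M" "submodular M (predim R)" "triple_resolvable M (predim R)"
    using M submodular_predim triple_resolvable_predim by auto
  show "triple_rich TYPE('b) M (predim R)" by (rule triple_rich_predim[OF assms(1)])
  show "countable Msym" "strong (predim_s Msym Rsym) {} Msym" "submodular Msym (predim_s Msym Rsym)"
    "triple_resolvable Msym (predim_s Msym Rsym)"
    using N strong_predim_s[OF N(2,3,3)] submodular_predim_s triple_resolvable_predim_s by auto
  show "triple_rich TYPE('a) Msym (predim_s Msym Rsym)" by (rule triple_rich_predim_s[OF assms(2)])
  show "predim R {} = predim_s Msym Rsym {}"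
    using predim_s_eq[OF N(2,3), of "{}"] unfolding predim_def clique_predim_def by simp
qed

end
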